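(* Let $\Phi=D_nv$ be a dihedral configuration of $2n$ unit vectors in $\mathbb{C}^n$. Then, up to switching equivalence, the Gram matrix of $\Phi$ can be partitioned as $$\Phi^*\Phi=\begin{bmatrix}A & B\\ B^\top & A^\top\end{bmatrix},\qquad A\in\mathbb{C}^{n\times n}\text{ Hermitian},\ B\in\mathbb{R}^{n\times n}.$$ Moreover, if $\Phi$ is strict (resp. genuine projective), then both $A$ and $B$ can be taken to be circulant (resp. negacirculant). Conversely, if $\Phi$ is a reduced configuration of $2n$ unit vectors in $\mathbb{C}^n$ whose Gram matrix is switching equivalent to a matrix $[A,B;B^\top,A^\top]$ with $A$ Hermitian, $B$ real, and $A,B$ both circulant (resp. both negacirculant), then $\Phi$ is a strict (resp. genuine projective) dihedral configuration.
   Context: $D_n$ is the group generated by $\mu,\tau$ with $\mu^n=\tau^2=1$, $\tau\mu=\mu^{-1}\tau$, with elements ordered $1,\mu,\dots,\mu^{n-1},\tau,\mu\tau,\dots,\mu^{n-1}\tau$. A projective unitary representation $\pi:D_n\to U(n)$ is a map with $\pi(gg')$ equal to $\pi(g)\pi(g')$ up to a unimodular scalar; it is strict if it is a homomorphism; two projective representations $\pi,\pi'$ are equivalent if $Q\pi(g)Q^*$ equals $\pi'(g)$ up to unimodular scalars for some fixed unitary $Q$. A dihedral configuration $D_nv$ is the ordered family $(\pi(g)v)_{g\in D_n}$ for a unit vector $v\in\mathbb{C}^n$ and a projective unitary representation $\pi$; it is strict if $\pi$ is equivalent to a strict representation and genuine projective otherwise. Configurations $\Phi,\Psi\in\mathbb{C}^{n\times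 N}$ (columns = vectors) are switching equivalent if $\Psi=Q\Phi\Pi^*$ for a unitary $Q$ and a phase monomial matrix $\Pi$ (product of a diagonal matrix with unimodular diagonal and a permutation matrix); correspondingly, Gram matrices $S,S'$ are switching equivalent if $S'=\Pi S\Pi^*$ for a phase monomial $\Pi$. A configuration is reduced if no two of its vectors are proportional. An $n\times n$ matrix $C$ is circulant if $C_{i,j}$ depends only on $(j-i)\bmod n$; it is negacirculant if there is $v=(v_0,\dots,v_{n-1})$ with $C_{i,j}=v_{j-i}$ for $j\ge i$ and $C_{i,j}=-v_{n+j-i}$ for $j<i$ (indices $0,\dots,n-1$).
   Formalization: In the converse, the dihedral configuration is Φ with its columns reordered by the permutation in the switching; in the negacirculant case Φ is shown dihedral for all n but genuine projective only for even n, since for odd n no genuine projective configuration exists. *)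

theory Defs
  imports
    "Jordan_Normal_Form.Schur_Decomposition"
    "HOL-Algebra.Generated_Groups"
    "HOL-Combinatorics.Permutations"
begin

text \<open>The pair \<open>(a, e)\<close> with \<open>a < n\<close> encodes the group element \<open>\<mu>\<^sup>a \<tau>\<^sup>e\<close>; the product comes from
  \<open>\<tau> \<mu>\<^sup>b = \<mu>\<^sup>-\<^sup>b \<tau>\<close>.\<close>

definition dihedral_group :: "nat \<Rightarrow> (nat \<times> bool) monoid" where
  "dihedral_group n =
     \<lparr>carrier = {..<n} \<times> UNIV,
      monoid.mult = (\<lambda>(a, e) (b, f). ((if e then a + (n - b) else a + b) mod n, e \<noteq> f)),
      monoid.one = (0, False)\<rparr>"

definition dihedral_mu :: "nat \<Rightarrow> nat \<times> bool" where
  "dihedral_mu n = (1 mod n, False)"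

definition dihedral_tau :: "nat \<times> bool" where
  "dihedral_tau = (0, True)"

text \<open>The enumeration \<open>1, \<mu>, \<dots>, \<mu>\<^sup>n\<^sup>-\<^sup>1, \<tau>, \<mu>\<tau>, \<dots>, \<mu>\<^sup>n\<^sup>-\<^sup>1\<tau>\<close>.\<close>

definition dihedral_elem :: "nat \<Rightarrow> nat \<Rightarrow> nat \<times> bool" where
  "dihedral_elem n j = (if j < n then (j, False) else (j - n, True))"

lemma dihedral_group_sel [simp]:
  "carrier (dihedral_group n) = {..<n} \<times> UNIV"
  "(a, e) \<otimes>\<^bsub>dihedral_group n\<^esub> (b, f) = ((if e then a + (n - b) else a + b) mod n, e \<noteq> f)"
  "\<one>\<^bsub>dihedral_group n\<^esub> = (0, False)"
  by (simp_all add: dihedral_group_def)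

lemma mod_sub_int:
  fixes a b n :: nat
  assumes "b \<le> n"
  shows "int ((a + (n - b)) mod n) = (int a - int b) mod int n"
proof -
  have "int ((a + (n - b)) mod n) = ((int a - int b) + int n) mod int n"
    using assms by (simp add: zmod_int of_nat_diff algebra_simps)
  then show ?thesis by simp
qed

lemma group_dihedral_group:
  assumes "n \<ge> 1"
  shows "group (dihedral_group n)"
proof (rule groupI)
  let ?G = "dihedral_group n"
  show "x \<otimes>\<^bsub>?G\<^esub> y \<in> carrier ?G" if "x \<in> carrier ?G" "y \<in> carrier ?G" for x y
    using that assms by (cases x; cases y) auto
  show "\<one>\<^bsub>?G\<^esub> \<in> carrier ?G"
    using assms by auto
  show "x \<otimes>\<^bsub>?G\<^esub> y \<otimes>\<^bsub>?G\<^esub> z = x \<otimes>\<^bsub>?G\<^esub> (y \<otimes>\<^bsub>?G\<^esub> z)"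
    if "x \<in> carrier ?G" "y \<in> carrier ?G" "z \<in> carrier ?G" for x y z
  proof -
    obtain a e b f c g where [simp]: "x = (a, e)" "y = (b, f)" "z = (c, g)"
      by (cases x; cases y; cases z) blast
    have less: "a < n" "b < n" "c < n" using that by auto
    let ?s = "\<lambda>e a b. (if e then a + (n - b) else a + b) mod n"
    have s: "int (?s e a b) = (if e then (int a - int b) mod int n else (int a + int b) mod int n)"
      if "b \<le> n" for e a b
      using mod_sub_int[OF that] by (simp add: zmod_int)
    have lt: "?s e a b \<le> n" for e a b
      using assms by (simp add: less_imp_le)
    have "int (?s (e \<noteq> f) (?s e a b) c) = int (?s e a (?s f b c))"
      using less
      by (simp only: s lt less_imp_le)
         (cases e; cases f; simp add: mod_simps algebra_simps)
    then have "?s (e \<noteq> f) (?s e a b) c = ?s e a (?s f b c)"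
      by (simp only: of_nat_eq_iff)
    moreover have "((e \<noteq> f) \<noteq> g) = (e \<noteq> (f \<noteq> g))"
      by blast
    ultimately show ?thesis
      by simp
  qed
  show "\<one>\<^bsub>?G\<^esub> \<otimes>\<^bsub>?G\<^esub> x = x" if "x \<in> carrier ?G" for x
    using that by (cases x) auto
  show "\<exists>y\<in>carrier ?G. y \<otimes>\<^bsub>?G\<^esub> x = \<one>\<^bsub>?G\<^esub>" if "x \<in> carrier ?G" for x
  proof (cases x)
    case (Pair a e)
    show ?thesis
    proof (cases e)
      case True
      then show ?thesis
        using Pair that assms by (intro bexI[of _ "(a, True)"]) auto
    next
      case False
      then show ?thesis
        using Pair that assms
        by (intro bexI[of _ "((n - a) mod n, False)"]) (auto simp: mod_simps)
    qed
  qed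
qed

lemma order_dihedral_group: "Coset.order (dihedral_group n) = 2 * n"
  by (simp add: Coset.order_def card_cartesian_product)

lemma dihedral_mu_pow:
  assumes "n \<ge> 1"
  shows "dihedral_mu n [^]\<^bsub>dihedral_group n\<^esub> (k::nat) = (k mod n, False)"
proof (induction k)
  case 0
  then show ?case using assms by (simp add: nat_pow_def)
next
  case (Suc k)
  then show ?case
    by (simp add: nat_pow_def dihedral_mu_def mod_simps)
qed

text \<open>Together with the order \<open>2n\<close>, the next two lemmas identify \<open>dihedral_group n\<close> with the
  group presented by the generators and relations of \<open>D\<^sub>n\<close>.\<close>

lemma dihedral_relations:
  assumes "n \<ge> 1"
  defines "G \<equiv> dihedral_group n"
  shows "dihedral_mu n [^]\<^bsub>G\<^esub> n = \<one>\<^bsub>G\<^esub>"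
    and "dihedral_tau \<otimes>\<^bsub>G\<^esub> dihedral_tau = \<one>\<^bsub>G\<^esub>"
    and "dihedral_tau \<otimes>\<^bsub>G\<^esub> dihedral_mu n = inv\<^bsub>G\<^esub> (dihedral_mu n) \<otimes>\<^bsub>G\<^esub> dihedral_tau"
proof -
  interpret group G unfolding G_def by (rule group_dihedral_group) fact
  show "dihedral_mu n [^]\<^bsub>G\<^esub> n = \<one>\<^bsub>G\<^esub>"
    using dihedral_mu_pow[OF assms(1)] by (simp add: G_def)
  show "dihedral_tau \<otimes>\<^bsub>G\<^esub> dihedral_tau = \<one>\<^bsub>G\<^esub>"
    by (simp add: G_def dihedral_tau_def)
  have inv: "inv\<^bsub>G\<^esub> (dihedral_mu n) = ((n - 1) mod n, False)"
    using assms(1)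
    by (intro inv_equality) (auto simp: G_def dihedral_mu_def mod_simps)
  show "dihedral_tau \<otimes>\<^bsub>G\<^esub> dihedral_mu n = inv\<^bsub>G\<^esub> (dihedral_mu n) \<otimes>\<^bsub>G\<^esub> dihedral_tau"
    unfolding inv using assms(1)
    by (cases "n = 1") (auto simp: G_def dihedral_mu_def dihedral_tau_def)
qed

lemma dihedral_elem_eq:
  assumes "n \<ge> 1" and "j < n"
  defines "G \<equiv> dihedral_group n"
  shows "dihedral_elem n j = dihedral_mu n [^]\<^bsub>G\<^esub> j"
    and "dihedral_elem n (n + j) = dihedral_mu n [^]\<^bsub>G\<^esub> j \<otimes>\<^bsub>G\<^esub> dihedral_tau"
  using assms dihedral_mu_pow[OF assms(1)]
  by (auto simp: dihedral_elem_def dihedral_tau_def G_def)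

lemma dihedral_generate:
  assumes "n \<ge> 1"
  shows "generate (dihedral_group n) {dihedral_mu n, dihedral_tau} = carrier (dihedral_group n)"
proof
  let ?G = "dihedral_group n" and ?H = "{dihedral_mu n, dihedral_tau}"
  interpret group ?G by (rule group_dihedral_group) fact
  have H: "?H \<subseteq> carrier ?G"
    using assms by (auto simp: dihedral_mu_def dihedral_tau_def)
  show "generate ?G ?H \<subseteq> carrier ?G"
    using generate_incl[OF H] .
  show "carrier ?G \<subseteq> generate ?G ?H"
  proof
    fix x assume x: "x \<in> carrier ?G"
    obtain a e where [simp]: "x = (a, e)" by (cases x)
    have a: "a < n" using x by simp
    have pow: "dihedral_mu n [^]\<^bsub>?G\<^esub> k \<in> generate ?G ?H" for k :: nat
      using generate.one[of ?G ?H]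
      by (induction k) (auto simp: nat_pow_def intro: generate.eng generate.incl)
    have "x = dihedral_mu n [^]\<^bsub>?G\<^esub> a \<otimes>\<^bsub>?G\<^esub> (if e then dihedral_tau else \<one>\<^bsub>?G\<^esub>)"
      using a dihedral_mu_pow[OF assms] by (simp add: dihedral_tau_def)
    moreover have "(if e then dihedral_tau else \<one>\<^bsub>?G\<^esub>) \<in> generate ?G ?H"
      using generate.one[of ?G ?H] by (auto intro: generate.incl)
    ultimately show "x \<in> generate ?G ?H"
      using generate.eng[OF pow] by simp
  qed
qed

definition unitary_mat :: "nat \<Rightarrow> complex mat \<Rightarrow> bool" where
  "unitary_mat d U \<longleftrightarrow> U \<in> carrier_mat d d \<and> mat_adjoint U * U = 1\<^sub>m d"

definition projective_rep :: "('g, 'x) monoid_scheme \<Rightarrow> nat \<Rightarrow> ('g \<Rightarrow> complex mat) \<Rightarrow> bool" where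
  "projective_rep G d \<pi> \<longleftrightarrow>
     (\<forall>g\<in>carrier G. unitary_mat d (\<pi> g)) \<and>
     (\<forall>g\<in>carrier G. \<forall>h\<in>carrier G. \<exists>c. cmod c = 1 \<and> \<pi> (g \<otimes>\<^bsub>G\<^esub> h) = c \<cdot>\<^sub>m (\<pi> g * \<pi> h))"

definition strict_rep :: "('g, 'x) monoid_scheme \<Rightarrow> nat \<Rightarrow> ('g \<Rightarrow> complex mat) \<Rightarrow> bool" where
  "strict_rep G d \<pi> \<longleftrightarrow>
     projective_rep G d \<pi> \<and>
     (\<forall>g\<in>carrier G. \<forall>h\<in>carrier G. \<pi> (g \<otimes>\<^bsub>G\<^esub> h) = \<pi> g * \<pi> h)"

definition equivalent_reps ::
  "('g, 'x) monoid_scheme \<Rightarrow> nat \<Rightarrow> ('g \<Rightarrow> complex mat) \<Rightarrow> ('g \<Rightarrow> complex mat) \<Rightarrow> bool" where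
  "equivalent_reps G d \<pi> \<pi>' \<longleftrightarrow>
     (\<exists>Q. unitary_mat d Q \<and>
        (\<forall>g\<in>carrier G. \<exists>c. cmod c = 1 \<and> Q * \<pi> g * mat_adjoint Q = c \<cdot>\<^sub>m \<pi>' g))"

definition strict_type :: "('g, 'x) monoid_scheme \<Rightarrow> nat \<Rightarrow> ('g \<Rightarrow> complex mat) \<Rightarrow> bool" where
  "strict_type G d \<pi> \<longleftrightarrow> (\<exists>\<rho>. strict_rep G d \<rho> \<and> equivalent_reps G d \<pi> \<rho>)"

text \<open>A configuration is the matrix whose columns are its vectors, in order.\<close>

definition unit_config :: "nat \<Rightarrow> nat \<Rightarrow> complex mat \<Rightarrow> bool" where
  "unit_config d N \<Phi> \<longleftrightarrow> \<Phi> \<in> carrier_mat d N \<and> (\<forall>j<N. col \<Phi> j \<bullet>c col \<Phi> j = 1)"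

definition reduced_config :: "nat \<Rightarrow> complex mat \<Rightarrow> bool" where
  "reduced_config N \<Phi> \<longleftrightarrow> (\<forall>i<N. \<forall>j<N. i \<noteq> j \<longrightarrow> (\<nexists>c. col \<Phi> i = c \<cdot>\<^sub>v col \<Phi> j))"

definition dihedral_orbit :: "nat \<Rightarrow> (nat \<times> bool \<Rightarrow> complex mat) \<Rightarrow> complex vec \<Rightarrow> complex mat" where
  "dihedral_orbit n \<pi> v =
     mat_of_cols n (map (\<lambda>j. \<pi> (dihedral_elem n j) *\<^sub>v v) [0..<2 * n])"

definition is_dihedral_orbit ::
  "nat \<Rightarrow> (nat \<times> bool \<Rightarrow> complex mat) \<Rightarrow> complex mat \<Rightarrow> bool" where
  "is_dihedral_orbit n \<pi> \<Phi> \<longleftrightarrow>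
     projective_rep (dihedral_group n) n \<pi> \<and>
     (\<exists>v\<in>carrier_vec n. v \<bullet>c v = 1 \<and> \<Phi> = dihedral_orbit n \<pi> v)"

definition dihedral_config :: "nat \<Rightarrow> complex mat \<Rightarrow> bool" where
  "dihedral_config n \<Phi> \<longleftrightarrow> (\<exists>\<pi>. is_dihedral_orbit n \<pi> \<Phi>)"

definition strict_dihedral_config :: "nat \<Rightarrow> complex mat \<Rightarrow> bool" where
  "strict_dihedral_config n \<Phi> \<longleftrightarrow>
     (\<exists>\<pi>. is_dihedral_orbit n \<pi> \<Phi> \<and> strict_type (dihedral_group n) n \<pi>)"

text \<open>For odd \<open>n\<close> no configuration is genuine projective: rescaling \<open>\<pi>(\<mu>)\<close> and \<open>\<pi>(\<tau>)\<close> gives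
  unitaries \<open>M, T\<close> with \<open>T\<close> an involution, \<open>TMT\<close> the inverse of \<open>M\<close>, and the \<open>n\<close>-th power of
  \<open>M\<close> equal to \<open>1\<close> or \<open>-1\<close>; in the latter case \<open>-M, T\<close> generate a strict representation.\<close>

definition genuine_dihedral_config :: "nat \<Rightarrow> complex mat \<Rightarrow> bool" where
  "genuine_dihedral_config n \<Phi> \<longleftrightarrow>
     (\<exists>\<pi>. is_dihedral_orbit n \<pi> \<Phi> \<and> \<not> strict_type (dihedral_group n) n \<pi>)"

definition gram :: "complex mat \<Rightarrow> complex mat" where
  "gram \<Phi> = mat_adjoint \<Phi> * \<Phi>"

definition perm_mat :: "nat \<Rightarrow> (nat \<Rightarrow> nat) \<Rightarrow> complex mat" where
  "perm_mat N \<sigma> = mat N N (\<lambda>(i, j). if i = \<sigma> j then 1 else 0)"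

definition phase_monomial :: "nat \<Rightarrow> complex mat \<Rightarrow> bool" where
  "phase_monomial N M \<longleftrightarrow>
     (\<exists>d \<sigma>. (\<forall>i<N. cmod (d i) = 1) \<and> \<sigma> permutes {..<N} \<and> M = mat_diag N d * perm_mat N \<sigma>)"

definition switching_equiv :: "nat \<Rightarrow> complex mat \<Rightarrow> complex mat \<Rightarrow> bool" where
  "switching_equiv N S S' \<longleftrightarrow> (\<exists>M. phase_monomial N M \<and> S' = M * S * mat_adjoint M)"

text \<open>Switching equivalence with the underlying permutation \<open>\<sigma>\<close> made explicit, so that the order
  of the columns can be tracked: \<open>D\<^sub>nv\<close> is an ordered family, whereas a switching
  may reorder the vectors.\<close>

definition switching_equiv_via ::
  "nat \<Rightarrow> (nat \<Rightarrow> nat) \<Rightarrow> complex mat \<Rightarrow> complex mat \<Rightarrow> bool" where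
  "switching_equiv_via N \<sigma> S S' \<longleftrightarrow>
     \<sigma> permutes {..<N} \<and>
     (\<exists>d. (\<forall>i<N. cmod (d i) = 1) \<and>
        S' = (mat_diag N d * perm_mat N \<sigma>) * S * mat_adjoint (mat_diag N d * perm_mat N \<sigma>))"

lemma switching_equiv_iff_via:
  "switching_equiv N S S' \<longleftrightarrow> (\<exists>\<sigma>. switching_equiv_via N \<sigma> S S')"
  unfolding switching_equiv_def switching_equiv_via_def phase_monomial_def by blast

definition permute_config :: "nat \<Rightarrow> (nat \<Rightarrow> nat) \<Rightarrow> complex mat \<Rightarrow> complex mat" where
  "permute_config N \<sigma> \<Phi> = \<Phi> * transpose_mat (perm_mat N \<sigma>)"

definition circulant :: "nat \<Rightarrow> 'a mat \<Rightarrow> bool" where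
  "circulant n C \<longleftrightarrow>
     (\<exists>c. \<forall>i<n. \<forall>j<n. C $$ (i, j) = c ((int j - int i) mod int n))"

definition negacirculant :: "nat \<Rightarrow> 'a :: group_add mat \<Rightarrow> bool" where
  "negacirculant n C \<longleftrightarrow>
     (\<exists>v\<in>carrier_vec n. \<forall>i<n. \<forall>j<n.
        C $$ (i, j) = (if i \<le> j then v $ (j - i) else - (v $ (n + j - i))))"

definition dihedral_blocks :: "nat \<Rightarrow> complex mat \<Rightarrow> real mat \<Rightarrow> bool" where
  "dihedral_blocks n A B \<longleftrightarrow>
     A \<in> carrier_mat n n \<and> mat_adjoint A = A \<and> B \<in> carrier_mat n n"

definition block_gram :: "complex mat \<Rightarrow> real mat \<Rightarrow> complex mat" where
  "block_gram A B =
     four_block_mat A (map_mat complex_of_real B)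
       (transpose_mat (map_mat complex_of_real B)) (transpose_mat A)"

end

theory Submission
  imports Defs
begin

text \<open>After rescaling, a projective representation of \<open>D\<^sub>n\<close> is given by unitaries \<open>M, T\<close> with
  \<open>T\<close> an involution, \<open>T M T\<close> the inverse of \<open>M\<close>, and the \<open>n\<close>-th power of \<open>M\<close> equal to a sign
  \<open>s\<close>; it is of strict type if \<open>s = 1\<close>, and for even \<open>n\<close> only then. The Gram matrix of the orbit of \<open>v\<close>
  consists of the numbers \<open>\<langle>v, M\<^sup>k v\<rangle>\<close> and \<open>\<langle>v, M\<^sup>k T v\<rangle>\<close>, the latter real because \<open>M\<^sup>k T\<close> is a
  unitary involution, and \<open>s\<close> decides between circulant and negacirculant blocks.

  Conversely, the symmetries of such a Gram matrix define \<open>M\<close> and \<open>T\<close> on the span of the vectors,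
  and they have to be extended to the orthogonal complement. The only obstruction is that for even \<open>n\<close>
  and \<open>s = -1\<close> the complement must have even dimension, which holds because every space carrying
  such a pair does.\<close>

section \<open>Unitary matrices and spanning families\<close>

text \<open>That \<open>s\<close> is a sign follows from the relations: \<open>(T M^n)^2 = 1\<close>
  and \<open>M^n = s\<close> give \<open>s^2 = 1\<close>. It enters a Gram matrix exactly when an
  exponent passes a multiple of \<open>n\<close>, which is the sign change below the diagonal of a
  negacirculant block. The unimodular scalars of a projective representation correspond to the
  diagonal part of a switching, so both directions compute with the exact words
  \<open>M^k T^e\<close> and restore the phases at the end. The permutation part is not absorbed in
  this way, and the converse yields an orbit for the reordered columns.

  In the converse, \<open>2n\<close> vectors in dimension \<open>n\<close> are linearly dependent,
  so a symmetry of the Gram matrix cannot simply be prescribed on them as on a basis. It becomes a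
  unitary because two families with the same Gram matrix differ by a unitary of the space spanned by
  the first. On the complement, for \<open>s = -1\<close> and even \<open>n\<close>, the building
  block is two-dimensional: a diagonal matrix with entries \<open>z\<close> and
  \<open>cnj z\<close>, where \<open>z^n = -1\<close>, together with the swap of the two
  coordinates.\<close>

definition full_family :: "nat \<Rightarrow> nat \<Rightarrow> (nat \<Rightarrow> complex vec) \<Rightarrow> bool" where
  "full_family d N p \<longleftrightarrow> (\<forall>j<N. p j \<in> carrier_vec d) \<and>
     (\<forall>w\<in>carrier_vec d. (\<forall>j<N. p j \<bullet>c w = 0) \<longrightarrow> w = 0\<^sub>v d)"

lemma mat_adjoint_dims [simp]:
  "dim_row (mat_adjoint A) = dim_col A" "dim_col (mat_adjoint A) = dim_row A"
  by (simp_all add: mat_adjoint_def)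

lemma mat_adjoint_carrier [simp]:
  "A \<in> carrier_mat n m \<Longrightarrow> mat_adjoint A \<in> carrier_mat m n"
  by (auto intro!: carrier_matI)

lemma index_mat_adjoint [simp]:
  "i < dim_col A \<Longrightarrow> j < dim_row A \<Longrightarrow> mat_adjoint A $$ (i, j) = conjugate (A $$ (j, i))"
  by (simp add: mat_adjoint_def mat_of_rows_index)

lemma mat_adjoint_adjoint [simp]: "mat_adjoint (mat_adjoint A) = A"
  by (intro eq_matI) auto

lemma mat_adjoint_one [simp]: "mat_adjoint (1\<^sub>m d :: complex mat) = 1\<^sub>m d"
  by (intro eq_matI) auto

lemma cscalar_prod_mult_mat_vec:
  fixes A :: "complex mat"
  assumes "A \<in> carrier_mat n m" "x \<in> carrier_vec m" "y \<in> carrier_vec n"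
  shows "(A *\<^sub>v x) \<bullet>c y = x \<bullet>c (mat_adjoint A *\<^sub>v y)"
proof -
  have "(A *\<^sub>v x) \<bullet>c y = (\<Sum>i<n. \<Sum>j<m. A $$ (i, j) * x $ j * cnj (y $ i))"
    using assms by (simp add: scalar_prod_def sum_distrib_right lessThan_atLeast0)
  also have "\<dots> = (\<Sum>j<m. \<Sum>i<n. A $$ (i, j) * x $ j * cnj (y $ i))"
    by (rule sum.swap)
  also have "\<dots> = x \<bullet>c (mat_adjoint A *\<^sub>v y)"
    using assms by (simp add: scalar_prod_def sum_distrib_left lessThan_atLeast0 mult_ac)
  finally show ?thesis .
qed

lemma mat_adjoint_mult:
  fixes A B :: "complex mat"
  assumes "A \<in> carrier_mat n m" "B \<in> carrier_mat m k"
  shows "mat_adjoint (A * B) = mat_adjoint B * mat_adjoint A"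
  by (rule eq_matI) (use assms in \<open>auto simp: scalar_prod_def mult.commute\<close>)

lemma cscalar_prod_commute:
  fixes x y :: "complex vec"
  assumes "x \<in> carrier_vec d" "y \<in> carrier_vec d"
  shows "y \<bullet>c x = cnj (x \<bullet>c y)"
  using assms by (simp add: scalar_prod_def mult.commute)

lemma cscalar_prod_diff_right:
  fixes x u v :: "complex vec"
  assumes "x \<in> carrier_vec d" "u \<in> carrier_vec d" "v \<in> carrier_vec d"
  shows "x \<bullet>c (u - v) = x \<bullet>c u - x \<bullet>c v"
  using assms by (simp add: scalar_prod_def algebra_simps sum_subtractf)

lemma cscalar_prod_smult:
  fixes x y :: "complex vec"
  assumes "x \<in> carrier_vec d" "y \<in> carrier_vec d"
  shows "(c \<cdot>\<^sub>v x) \<bullet>c y = c * (x \<bullet>c y)" "x \<bullet>c (c \<cdot>\<^sub>v y) = cnj c * (x \<bullet>c y)"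
  using assms by (simp_all add: scalar_prod_def sum_distrib_left mult_ac)

lemma unitary_matD:
  assumes "unitary_mat d U"
  shows "U \<in> carrier_mat d d" "mat_adjoint U * U = 1\<^sub>m d" "U * mat_adjoint U = 1\<^sub>m d"
  using assms mat_mult_left_right_inverse[of "mat_adjoint U" d U]
  by (auto simp: unitary_mat_def)

lemma unitary_mat_adjoint:
  assumes "unitary_mat d U"
  shows "unitary_mat d (mat_adjoint U)"
  using unitary_matD[OF assms] unfolding unitary_mat_def by simp

lemma unitary_mat_one: "unitary_mat d (1\<^sub>m d)"
  by (simp add: unitary_mat_def)

lemma unitary_mat_mult_adjoint_vec:
  assumes "unitary_mat d U" "x \<in> carrier_vec d"
  shows "mat_adjoint U *\<^sub>v (U *\<^sub>v x) = x" "U *\<^sub>v (mat_adjoint U *\<^sub>v x) = x"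
  using unitary_matD[OF assms(1)] assms(2)
  by (simp_all flip: assoc_mult_mat_vec[where ?n\<^sub>1 = d and ?n\<^sub>2 = d and ?n\<^sub>3 = d])

lemma unitary_mat_cscalar_prod:
  assumes "unitary_mat d U" "x \<in> carrier_vec d" "y \<in> carrier_vec d"
  shows "(U *\<^sub>v x) \<bullet>c (U *\<^sub>v y) = x \<bullet>c y"
  using assms unitary_matD(1)[OF assms(1)]
  by (subst cscalar_prod_mult_mat_vec[of _ d d]) (auto simp: unitary_mat_mult_adjoint_vec)

lemma unitary_mat_mult:
  assumes "unitary_mat d U" "unitary_mat d V"
  shows "unitary_mat d (U * V)"
proof -
  note U = unitary_matD[OF assms(1)] and V = unitary_matD[OF assms(2)]
  have "mat_adjoint (U * V) * (U * V) = mat_adjoint V * ((mat_adjoint U * U) * V)"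
    using U(1) V(1) by (simp add: mat_adjoint_mult[of _ d d _ d] assoc_mult_mat[of _ d d _ d _ d])
  then show ?thesis
    using U V by (simp add: unitary_mat_def)
qed

lemma mat_adjoint_smult:
  "mat_adjoint (c \<cdot>\<^sub>m A) = cnj c \<cdot>\<^sub>m mat_adjoint (A :: complex mat)"
  by (rule eq_matI) auto

lemma unitary_mat_smult:
  assumes "unitary_mat d U" "cmod c = 1"
  shows "unitary_mat d (c \<cdot>\<^sub>m U)"
proof -
  note U = unitary_matD[OF assms(1)]
  have "cnj c * c = 1"
    using assms(2) complex_norm_square[of c] by (simp add: mult.commute)
  then show ?thesis
    using U by (auto simp: unitary_mat_def mat_adjoint_smult mult_smult_distrib[of _ d d]
        mult_smult_assoc_mat[of _ d d] mult.commute mult.left_commute intro!: eq_matI)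
qed

lemma unitary_mat_pow:
  assumes "unitary_mat d U"
  shows "unitary_mat d (U ^\<^sub>m k)"
  using assms unitary_matD(1)[OF assms]
  by (induction k) (auto simp: unitary_mat_one intro: unitary_mat_mult)

lemma mult_mat_unit_vec:
  fixes A :: "complex mat"
  assumes "A \<in> carrier_mat n m" "j < m"
  shows "A *\<^sub>v unit_vec m j = col A j"
  by (rule eq_vecI) (use assms in \<open>auto simp: scalar_prod_right_unit\<close>)

lemma eq_mat_on_vecI:
  fixes A B :: "complex mat"
  assumes "A \<in> carrier_mat n m" "B \<in> carrier_mat n m"
    and "\<And>v. v \<in> carrier_vec m \<Longrightarrow> A *\<^sub>v v = B *\<^sub>v v"
  shows "A = B"
proof (rule eq_matI)
  fix i j assume "i < dim_row B" "j < dim_col B"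
  moreover have "col A j = col B j" if "j < m"
    using assms(3)[of "unit_vec m j"] assms(1,2) that by (auto simp: mult_mat_unit_vec)
  ultimately show "A $$ (i, j) = B $$ (i, j)"
    using assms(1,2) by (metis carrier_matD index_col)
qed (use assms in auto)

lemma vec_eq_if_diff_zero:
  fixes u v :: "complex vec"
  assumes "u \<in> carrier_vec d" "v \<in> carrier_vec d" "u - v = 0\<^sub>v d"
  shows "u = v"
proof (rule eq_vecI)
  fix i assume "i < dim_vec v"
  then have "u $ i - v $ i = (u - v) $ i" "(0\<^sub>v d :: complex vec) $ i = 0"
    using assms(2) by simp_all
  then show "u $ i = v $ i" by (simp add: assms(3))
qed (use assms in auto)

text \<open>\<open>full_family\<close> expresses spanning as triviality of the orthogonal
  complement, so no linear combinations are formed. Agreement on every \<open>p j\<close> makes the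
  difference of the two adjoints, applied to any \<open>w\<close>, orthogonal to the whole
  family.\<close>

lemma full_family_eqI:
  assumes p: "full_family d N p" and A: "A \<in> carrier_mat d d" and B: "B \<in> carrier_mat d d"
    and eq: "\<And>j. j < N \<Longrightarrow> A *\<^sub>v p j = B *\<^sub>v p j"
  shows "A = B"
proof -
  have "mat_adjoint A *\<^sub>v w = mat_adjoint B *\<^sub>v w" if w: "w \<in> carrier_vec d" for w
  proof -
    let ?u = "mat_adjoint A *\<^sub>v w" and ?v = "mat_adjoint B *\<^sub>v w"
    have uv: "?u \<in> carrier_vec d" "?v \<in> carrier_vec d"
      using A B w by (auto intro!: mult_mat_vec_carrier[of _ d d])
    have "p j \<bullet>c (?u - ?v) = 0" if j: "j < N" for j
    proof -
      have pj: "p j \<in> carrier_vec d" using p j by (auto simp: full_family_def)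
      have "p j \<bullet>c (?u - ?v) = p j \<bullet>c ?u - p j \<bullet>c ?v"
        using pj uv by (rule cscalar_prod_diff_right)
      also have "\<dots> = (A *\<^sub>v p j) \<bullet>c w - (B *\<^sub>v p j) \<bullet>c w"
        using A B w pj by (simp add: cscalar_prod_mult_mat_vec[of _ d d])
      finally show ?thesis using eq[OF j] by simp
    qed
    then have "?u - ?v = 0\<^sub>v d"
      using p uv by (simp add: full_family_def)
    then show ?thesis
      using vec_eq_if_diff_zero uv by blast
  qed
  then have "mat_adjoint A = mat_adjoint B"
    using A B by (intro eq_mat_on_vecI[of _ d d]) auto
  then show ?thesis by (metis mat_adjoint_adjoint)
qed

text \<open>With \<open>P\<close> and \<open>Q\<close> the matrices of columns \<open>p j\<close>
  and \<open>q j\<close>, equal Gram matrices make the kernel of \<open>P\<close> contained in that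
  of \<open>Q\<close>, and fullness gives \<open>P\<close> a right inverse. Composing that right
  inverse with \<open>Q\<close> is the desired map: the kernel inclusion makes the outcome
  independent of the choice of preimage.\<close>

lemma exists_unitary_mapping:
  assumes p: "full_family d N p" and q: "\<And>j. j < N \<Longrightarrow> q j \<in> carrier_vec d"
    and gram: "\<And>i j. i < N \<Longrightarrow> j < N \<Longrightarrow> q i \<bullet>c q j = p i \<bullet>c p j"
  obtains U where "unitary_mat d U" "\<And>j. j < N \<Longrightarrow> U *\<^sub>v p j = q j"
proof -
  define P where "P = mat_of_cols d (map p [0..<N])"
  define Q where "Q = mat_of_cols d (map q [0..<N])"
  have pc: "p j \<in> carrier_vec d" if "j < N" for j
    using p that by (auto simp: full_family_def)
  have PQ: "P \<in> carrier_mat d N" "Q \<in> carrier_mat d N"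
    by (auto simp: P_def Q_def)
  have adj: "mat_adjoint P \<in> carrier_mat N d" "mat_adjoint Q \<in> carrier_mat N d"
    using PQ by auto
  have Pcol: "P *\<^sub>v unit_vec N j = p j" and Qcol: "Q *\<^sub>v unit_vec N j = q j" if "j < N" for j
    using that PQ pc[OF that] q[OF that]
    by (simp_all add: mult_mat_unit_vec) (simp_all add: P_def Q_def)
  have adj_mult: "mat_adjoint P * P = mat_adjoint Q * Q"
  proof (rule eq_matI)
    fix i j assume "i < dim_row (mat_adjoint Q * Q)" "j < dim_col (mat_adjoint Q * Q)"
    then have ij: "i < N" "j < N" using PQ by auto
    have *: "(mat_adjoint X * X) $$ (i, j) = col X j \<bullet>c col X i" if "X \<in> carrier_mat d N" for X :: "complex mat"
      using that ij by (auto simp: scalar_prod_def mult.commute)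
    show "(mat_adjoint P * P) $$ (i, j) = (mat_adjoint Q * Q) $$ (i, j)"
      using gram[of j i] ij Pcol Qcol PQ *[OF PQ(1)] *[OF PQ(2)] by (simp add: mult_mat_unit_vec)
  qed (use PQ in auto)
  \<comment> \<open>Equal Gram matrices mean that \<open>Q x\<close> and \<open>P x\<close> have the
    same norm.\<close>
  have ker: "Q *\<^sub>v x = 0\<^sub>v d" if x: "x \<in> carrier_vec N" and "P *\<^sub>v x = 0\<^sub>v d" for x
  proof -
    have "(Q *\<^sub>v x) \<bullet>c (Q *\<^sub>v x) = x \<bullet>c ((mat_adjoint Q * Q) *\<^sub>v x)"
      using PQ x by (simp add: cscalar_prod_mult_mat_vec[of _ d N] assoc_mult_mat_vec[of _ N d _ N])
    also have "\<dots> = (P *\<^sub>v x) \<bullet>c (P *\<^sub>v x)"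
      using PQ x by (simp add: cscalar_prod_mult_mat_vec[of _ d N] assoc_mult_mat_vec[of _ N d _ N] flip: adj_mult)
    also have "\<dots> = 0" using that by simp
    finally show ?thesis
      using conjugate_square_eq_0_vec[of "Q *\<^sub>v x" d] PQ x by (meson mult_mat_vec_carrier)
  qed
  define K where "K = P * mat_adjoint P"
  have K: "K \<in> carrier_mat d d" using PQ by (auto simp: K_def)
  \<comment> \<open>A kernel vector \<open>w\<close> of \<open>K\<close> is killed by the adjoint of
    \<open>P\<close>, hence orthogonal to every \<open>p j\<close>, which contradicts
    fullness.\<close>
  have "det K \<noteq> 0"
  proof
    assume "det K = 0"
    then obtain w where w: "w \<in> carrier_vec d" "w \<noteq> 0\<^sub>v d" "K *\<^sub>v w = 0\<^sub>v d"
      using det_0_iff_vec_prod_zero[OF K] by auto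
    let ?z = "mat_adjoint P *\<^sub>v w"
    have z: "?z \<in> carrier_vec N" using adj w by (meson mult_mat_vec_carrier)
    have "?z \<bullet>c ?z = w \<bullet>c (K *\<^sub>v w)"
      using PQ w z by (simp add: K_def cscalar_prod_mult_mat_vec[of _ N d] assoc_mult_mat_vec[of _ d N _ d])
    then have "?z = 0\<^sub>v N"
      using w z by simp
    have "p j \<bullet>c w = 0" if "j < N" for j
    proof -
      have "p j \<bullet>c w = unit_vec N j \<bullet>c ?z"
        using w PQ Pcol[OF that] cscalar_prod_mult_mat_vec[OF PQ(1), of "unit_vec N j" w] by simp
      then show ?thesis using \<open>?z = 0\<^sub>v N\<close> by simp
    qed
    then show False using p w by (auto simp: full_family_def)
  qed
  then obtain L where L: "L \<in> carrier_mat d d" "K * L = 1\<^sub>m d" "L * K = 1\<^sub>m d"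
    using det_non_zero_imp_unit[OF K] by (auto simp: Units_def ring_mat_simps)
  \<comment> \<open>\<open>mat_adjoint P * L\<close> is a right inverse of \<open>P\<close>, because
    \<open>L\<close> inverts \<open>K\<close>.\<close>
  define U where "U = Q * (mat_adjoint P * L)"
  have U: "U \<in> carrier_mat d d" using PQ adj L by (auto simp: U_def)
  have Up: "U *\<^sub>v p j = q j" if j: "j < N" for j
  proof -
    let ?x = "mat_adjoint P *\<^sub>v (L *\<^sub>v p j)"
    have Lp: "L *\<^sub>v p j \<in> carrier_vec d" using L pc[OF j] by (meson mult_mat_vec_carrier)
    have x: "?x \<in> carrier_vec N" using adj Lp by (meson mult_mat_vec_carrier)
    have "P *\<^sub>v ?x = (K * L) *\<^sub>v p j"
      unfolding K_def using PQ L(1) Lp pc[OF j]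
      by (simp add: assoc_mult_mat_vec[of _ d d _ d] assoc_mult_mat_vec[of _ d N _ d])
    then have "P *\<^sub>v (?x - unit_vec N j) = 0\<^sub>v d"
      using x PQ Pcol[OF j] pc[OF j] L(2) by (simp add: mult_minus_distrib_mat_vec[of _ d N])
    then have "Q *\<^sub>v (?x - unit_vec N j) = 0\<^sub>v d"
      using ker x by simp
    then have "Q *\<^sub>v ?x - q j = 0\<^sub>v d"
      using x PQ Qcol[OF j] by (simp add: mult_minus_distrib_mat_vec[of _ d N])
    moreover have "Q *\<^sub>v ?x \<in> carrier_vec d" using x PQ by (meson mult_mat_vec_carrier)
    ultimately have "Q *\<^sub>v ?x = q j"
      using vec_eq_if_diff_zero q[OF j] by blast
    then show ?thesis
      unfolding U_def using PQ L(1) pc[OF j] Lp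
      by (simp add: assoc_mult_mat_vec[of _ d N _ d] assoc_mult_mat_vec[of _ N d _ d]
          mult_carrier_mat[of _ N d _ d])
  qed
  have aU: "mat_adjoint U \<in> carrier_mat d d" using U by simp
  \<comment> \<open>It suffices that the adjoint of \<open>U\<close> returns \<open>q j\<close> to
    \<open>p j\<close>; testing this against each \<open>p i\<close> is the Gram hypothesis once
    more.\<close>
  have "mat_adjoint U * U = 1\<^sub>m d"
  proof (rule full_family_eqI[OF p])
    fix j assume j: "j < N"
    let ?y = "mat_adjoint U *\<^sub>v q j"
    have y: "?y \<in> carrier_vec d" using aU q[OF j] by (meson mult_mat_vec_carrier)
    have "p i \<bullet>c (?y - p j) = 0" if i: "i < N" for i
    proof -
      have "p i \<bullet>c ?y = (U *\<^sub>v p i) \<bullet>c q j"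
        using cscalar_prod_mult_mat_vec[OF U pc[OF i] q[OF j]] by simp
      then show ?thesis
        using gram[OF i j] Up[OF i] pc[OF i] pc[OF j] y by (simp add: cscalar_prod_diff_right)
    qed
    then have "?y - p j = 0\<^sub>v d"
      using p y pc[OF j] by (simp add: full_family_def)
    then have "?y = p j" using vec_eq_if_diff_zero y pc[OF j] by blast
    then show "(mat_adjoint U * U) *\<^sub>v p j = 1\<^sub>m d *\<^sub>v p j"
      using U pc[OF j] Up[OF j] by (simp add: assoc_mult_mat_vec[of _ d d _ d])
  qed (use U aU in auto)
  then have "unitary_mat d U" using U by (simp add: unitary_mat_def)
  then show ?thesis using that Up by blast
qed

section \<open>Direct sums and splitting off the orthogonal complement\<close>

definition direct_sum :: "complex mat \<Rightarrow> complex mat \<Rightarrow> complex mat" where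
  "direct_sum A B = four_block_mat A (0\<^sub>m (dim_row A) (dim_col B)) (0\<^sub>m (dim_row B) (dim_col A)) B"

lemma direct_sum_carrier [simp]:
  "A \<in> carrier_mat r r \<Longrightarrow> B \<in> carrier_mat m m \<Longrightarrow> direct_sum A B \<in> carrier_mat (r + m) (r + m)"
  by (auto simp: direct_sum_def)

lemma direct_sum_mult:
  assumes "A \<in> carrier_mat r r" "B \<in> carrier_mat m m" "A' \<in> carrier_mat r r" "B' \<in> carrier_mat m m"
  shows "direct_sum A B * direct_sum A' B' = direct_sum (A * A') (B * B')"
  using assms unfolding direct_sum_def
  by (subst mult_four_block_mat[of _ r r _ m _ m _ _ r _ m]) auto

lemma direct_sum_one: "direct_sum (1\<^sub>m r) (1\<^sub>m m) = 1\<^sub>m (r + m)"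
  by (simp add: direct_sum_def)

lemma direct_sum_adjoint:
  assumes "A \<in> carrier_mat r r" "B \<in> carrier_mat m m"
  shows "mat_adjoint (direct_sum A B) = direct_sum (mat_adjoint A) (mat_adjoint B)"
  by (rule eq_matI) (use assms in \<open>auto simp: direct_sum_def\<close>)

lemma direct_sum_smult:
  assumes "A \<in> carrier_mat r r" "B \<in> carrier_mat m m"
  shows "direct_sum (c \<cdot>\<^sub>m A) (c \<cdot>\<^sub>m B) = c \<cdot>\<^sub>m direct_sum A B"
  by (rule eq_matI) (use assms in \<open>auto simp: direct_sum_def\<close>)

lemma direct_sum_pow:
  assumes "A \<in> carrier_mat r r" "B \<in> carrier_mat m m"
  shows "direct_sum A B ^\<^sub>m k = direct_sum (A ^\<^sub>m k) (B ^\<^sub>m k)"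
  using assms pow_four_block_mat[of A r B m k]
  by (simp add: direct_sum_def)

lemma direct_sum_mult_vec:
  assumes "A \<in> carrier_mat r r" "B \<in> carrier_mat m m" "x \<in> carrier_vec r" "y \<in> carrier_vec m"
  shows "direct_sum A B *\<^sub>v (x @\<^sub>v y) = (A *\<^sub>v x) @\<^sub>v (B *\<^sub>v y)"
  using mult_mat_vec_split[of A r B m x y] assms by (simp add: direct_sum_def)

lemma unitary_direct_sum:
  assumes "unitary_mat r A" "unitary_mat m B"
  shows "unitary_mat (r + m) (direct_sum A B)"
  using unitary_matD[OF assms(1)] unitary_matD[OF assms(2)] unfolding unitary_mat_def
  by (simp add: direct_sum_adjoint[of _ r _ m] direct_sum_mult[of _ r _ m] direct_sum_one)

text \<open>Complete \<open>w\<close> to a basis and orthogonalise it by Gram-Schmidt, which leaves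
  the first vector \<open>w\<close> unchanged. Such a \<open>W\<close> turns the direction of
  \<open>w\<close> into the last coordinate, where it can be split off.\<close>

lemma exists_unitary_last_col:
  assumes w: "w \<in> carrier_vec (Suc d)" "w \<noteq> 0\<^sub>v (Suc d)"
  obtains W :: "complex mat" and c
  where "unitary_mat (Suc d) W" "c \<noteq> 0" "col W d = c \<cdot>\<^sub>v w"
proof -
  interpret cof_vec_space "Suc d" "TYPE(complex)" .
  let ?b = "basis_completion w"
  define ws where "ws = gram_schmidt (Suc d) ?b"
  have len: "length ?b = Suc d" and hd: "hd ?b = w"
    using basis_completion[OF w] by auto
  then obtain vs where bv: "?b = w # vs" by (cases ?b) auto
  have ws: "set ws \<subseteq> carrier_vec (Suc d)" "corthogonal ws" "length ws = Suc d"
    using gram_schmidt_result[OF _ _ _ ws_def] basis_completion[OF w] by auto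
  have hdws: "ws ! 0 = w"
    using gram_schmidt_hd[OF w(1), of vs] bv ws(3) unfolding ws_def by (metis hd_conv_nth list.size(3) nat.distinct(1))
  \<comment> \<open>The index \<open>d - j\<close> reverses the list, so that \<open>w\<close> moves
    from the head to the last column.\<close>
  define u where "u j = ws ! (d - j)" for j
  have u: "u j \<in> carrier_vec (Suc d)" if "j < Suc d" for j
    using ws that by (auto simp: u_def)
  have orth: "u i \<bullet>c u j = 0 \<longleftrightarrow> i \<noteq> j" if "i < Suc d" "j < Suc d" for i j
    using corthogonalD[OF ws(2), of "d - i" "d - j"] ws(3) that by (auto simp: u_def)
  \<comment> \<open>Gram-Schmidt only yields nonzero orthogonal vectors; these factors normalise
    them. They are real, so conjugation leaves them fixed.\<close>
  define c where "c j = complex_of_real (1 / sqrt (Re (u j \<bullet>c u j)))" for j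
  have c: "c j \<noteq> 0" "c j * c j * (u j \<bullet>c u j) = 1" if "j < Suc d" for j
  proof -
    have "u j \<bullet>c u j > 0"
      using orth[OF that that] conjugate_square_ge_0_vec[of "u j"] by (simp add: less_le)
    then obtain x where x: "u j \<bullet>c u j = complex_of_real x" "x > 0"
      by (metis complex_is_Real_iff less_complex_def of_real_Re zero_complex.sel)
    then have "c j * c j * (u j \<bullet>c u j) = complex_of_real (1 / sqrt x * (1 / sqrt x) * x)"
      unfolding c_def x(1) by (simp only: of_real_mult Re_complex_of_real)
    also have "1 / sqrt x * (1 / sqrt x) * x = 1"
      using x by (simp add: divide_simps)
    finally show "c j \<noteq> 0" "c j * c j * (u j \<bullet>c u j) = 1"
      using x by (auto simp: c_def)
  qed
  define W where "W = mat_of_cols (Suc d) (map (\<lambda>j. c j \<cdot>\<^sub>v u j) [0..<Suc d])"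
  have W: "W \<in> carrier_mat (Suc d) (Suc d)" by (auto simp: W_def)
  have col: "col W j = c j \<cdot>\<^sub>v u j" if "j < Suc d" for j
    using that u by (simp add: W_def del: upt_Suc)
  have "mat_adjoint W * W = 1\<^sub>m (Suc d)"
  proof (rule eq_matI)
    fix i j assume "i < dim_row (1\<^sub>m (Suc d))" "j < dim_col (1\<^sub>m (Suc d))"
    then have ij: "i < Suc d" "j < Suc d" by auto
    have "(mat_adjoint W * W) $$ (i, j) = col W j \<bullet>c col W i"
      using ij W by (auto simp: scalar_prod_def mult.commute)
    also have "\<dots> = c i * c j * (u j \<bullet>c u i)"
      using ij u by (simp add: col cscalar_prod_smult[of _ "Suc d"]) (simp add: c_def)
    finally show "(mat_adjoint W * W) $$ (i, j) = 1\<^sub>m (Suc d) $$ (i, j)"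
      using ij orth[of j i] c[of i] by auto
  qed (use W in auto)
  then have "unitary_mat (Suc d) W" using W by (simp add: unitary_mat_def)
  moreover have "col W d = c d \<cdot>\<^sub>v w"
    using col[of d] hdws by (simp add: u_def)
  ultimately show ?thesis using that c[of d] by blast
qed

text \<open>Induction on the dimension: as long as some nonzero \<open>w\<close> is orthogonal to
  the family, rotate it to the last coordinate and drop that coordinate. At the end \<open>r\<close>
  is the dimension of the span, \<open>m\<close> that of its complement, and \<open>U\<close> the
  change to coordinates adapted to the two.\<close>

lemma exists_full_family:
  assumes "\<And>j. j < N \<Longrightarrow> p j \<in> carrier_vec d"
  shows "\<exists>r m U q. d = r + m \<and> unitary_mat d U \<and> full_family r N q \<and>
    (\<forall>j<N. p j = U *\<^sub>v (q j @\<^sub>v 0\<^sub>v m))"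
  using assms
proof (induction d arbitrary: p)
  case 0
  have "full_family 0 N p"
    using 0 by (auto simp: full_family_def)
  moreover have "p j = 1\<^sub>m 0 *\<^sub>v (p j @\<^sub>v 0\<^sub>v 0)" if "j < N" for j
    using 0[OF that] by auto
  ultimately show ?case
    using unitary_mat_one[of 0] by (metis add_0)
next
  case (Suc d)
  show ?case
  proof (cases "full_family (Suc d) N p")
    case True
    have "p j = 1\<^sub>m (Suc d) *\<^sub>v (p j @\<^sub>v 0\<^sub>v 0)" if "j < N" for j
    proof -
      have "p j @\<^sub>v 0\<^sub>v 0 = p j" by (intro eq_vecI) auto
      then show ?thesis using Suc.prems[OF that] by simp
    qed
    then show ?thesis
      using unitary_mat_one[of "Suc d"] True by (metis add_0_right)
  next
    case False
    then obtain w where w: "w \<in> carrier_vec (Suc d)" "w \<noteq> 0\<^sub>v (Suc d)"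
        "\<And>j. j < N \<Longrightarrow> p j \<bullet>c w = 0"
      using Suc.prems by (auto simp: full_family_def)
    obtain W c where W: "unitary_mat (Suc d) W" and Wc: "c \<noteq> 0" "col W d = c \<cdot>\<^sub>v w"
      using exists_unitary_last_col[OF w(1,2)] .
    note Wcar = unitary_matD(1)[OF W]
    define z where "z j = mat_adjoint W *\<^sub>v p j" for j
    have z: "z j \<in> carrier_vec (Suc d)" "W *\<^sub>v z j = p j" if "j < N" for j
      using Suc.prems[OF that] Wcar unitary_mat_mult_adjoint_vec[OF W Suc.prems[OF that]]
      by (auto simp: z_def intro: mult_mat_vec_carrier[of _ "Suc d" "Suc d"])
    \<comment> \<open>The last coordinate of \<open>z j\<close> is the inner product of
      \<open>p j\<close> with a multiple of \<open>w\<close>.\<close>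
    have z0: "z j $ d = 0" if "j < N" for j
    proof -
      have "z j $ d = p j \<bullet>c col W d"
        using Wcar Suc.prems[OF that] by (simp add: z_def scalar_prod_def mult.commute)
      then show ?thesis
        using w(3)[OF that] Suc.prems[OF that] w(1)
        by (simp add: Wc cscalar_prod_smult[of _ "Suc d"])
    qed
    define p' where "p' j = vec d (($) (z j))" for j
    have zp: "z j = p' j @\<^sub>v 0\<^sub>v 1" if "j < N" for j
      using z(1)[OF that] z0[OF that] by (intro eq_vecI) (auto simp: p'_def less_Suc_eq)
    obtain r m U q where IH: "d = r + m" "unitary_mat d U" "full_family r N q"
        "\<And>j. j < N \<Longrightarrow> p' j = U *\<^sub>v (q j @\<^sub>v 0\<^sub>v m)"
      using Suc.IH[of p'] by (force simp: p'_def)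
    define V where "V = W * direct_sum U (1\<^sub>m 1)"
    have dsU: "unitary_mat (Suc d) (direct_sum U (1\<^sub>m 1))"
      using unitary_direct_sum[OF IH(2) unitary_mat_one[of 1]] by simp
    have V: "unitary_mat (Suc d) V"
      unfolding V_def by (intro unitary_mat_mult W dsU)
    have "p j = V *\<^sub>v (q j @\<^sub>v 0\<^sub>v (Suc m))" if j: "j < N" for j
    proof -
      have qj: "q j \<in> carrier_vec r" using IH(3) j by (auto simp: full_family_def)
      have app: "q j @\<^sub>v 0\<^sub>v (Suc m) = (q j @\<^sub>v 0\<^sub>v m) @\<^sub>v 0\<^sub>v 1"
        using qj by (intro eq_vecI) auto
      have qc: "q j @\<^sub>v 0\<^sub>v m \<in> carrier_vec d" using qj IH(1) by auto
      have qc': "(q j @\<^sub>v 0\<^sub>v m) @\<^sub>v 0\<^sub>v 1 \<in> carrier_vec (Suc d)"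
        using qc append_carrier_vec[of "q j @\<^sub>v 0\<^sub>v m" d "0\<^sub>v 1" 1] by simp
      have "V *\<^sub>v (q j @\<^sub>v 0\<^sub>v (Suc m)) = W *\<^sub>v (direct_sum U (1\<^sub>m 1) *\<^sub>v ((q j @\<^sub>v 0\<^sub>v m) @\<^sub>v 0\<^sub>v 1))"
        unfolding V_def app using Wcar unitary_matD(1)[OF dsU] qc'
        by (simp add: assoc_mult_mat_vec[of _ "Suc d" "Suc d" _ "Suc d"])
      also have "\<dots> = W *\<^sub>v z j"
        using unitary_matD(1)[OF IH(2)] qc j IH(4)[OF j] zp[OF j]
        by (subst direct_sum_mult_vec[of _ d _ 1]) auto
      finally show ?thesis using z(2)[OF j] by simp
    qed
    then show ?thesis
      using V IH(1,3) by (metis add_Suc_right)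
  qed
qed

section \<open>Pairs of unitaries satisfying the dihedral relations\<close>

lemma mat_pow_add:
  assumes "A \<in> carrier_mat d d"
  shows "A ^\<^sub>m (j + k) = A ^\<^sub>m j * (A ^\<^sub>m k :: complex mat)"
  using assms
  by (induction k) (simp_all add: assoc_mult_mat[of _ d d _ d _ d, symmetric])

lemma smult_one_mat_mult_vec:
  fixes v :: "complex vec"
  assumes "v \<in> carrier_vec d"
  shows "(c \<cdot>\<^sub>m 1\<^sub>m d) *\<^sub>v v = c \<cdot>\<^sub>v v"
  by (rule eq_vecI) (use assms in auto)

lemma smult_mat_mult_vec:
  fixes A :: "complex mat"
  assumes "A \<in> carrier_mat n m" "v \<in> carrier_vec m"
  shows "(c \<cdot>\<^sub>m A) *\<^sub>v v = c \<cdot>\<^sub>v (A *\<^sub>v v)"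
  by (rule eq_vecI) (use assms in auto)

lemma smult_smult_mat: "c \<cdot>\<^sub>m (e \<cdot>\<^sub>m A) = (c * e :: complex) \<cdot>\<^sub>m A"
  by (rule eq_matI) auto

lemma one_smult_mat: "(1 :: complex) \<cdot>\<^sub>m A = A"
  by (rule eq_matI) auto

text \<open>The exponent is not reduced modulo \<open>n\<close>, so that words with any natural
  exponent can be compared with group elements.\<close>

definition dihedral_word ::
  "nat \<Rightarrow> complex mat \<Rightarrow> complex mat \<Rightarrow> nat \<times> bool \<Rightarrow> complex mat" where
  "dihedral_word d M T g = M ^\<^sub>m fst g * (if snd g then T else 1\<^sub>m d)"

text \<open>The scalar \<open>s\<close> is what is left of the cocycle after rescaling \<open>\<pi>(\<mu>)\<close> and \<open>\<pi>(\<tau>)\<close>.\<close>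

locale twisted_dihedral_pair =
  fixes d n :: nat and s :: complex and M T :: "complex mat"
  assumes unitary_M: "unitary_mat d M" and unitary_T: "unitary_mat d T"
    and T_T: "T * T = 1\<^sub>m d"
    and TM_TM: "(T * M) * (T * M) = 1\<^sub>m d"
    and M_pow_n: "M ^\<^sub>m n = s \<cdot>\<^sub>m 1\<^sub>m d"
begin

lemma M_carrier [simp]: "M \<in> carrier_mat d d"
  and T_carrier [simp]: "T \<in> carrier_mat d d"
  using unitary_M unitary_T by (auto dest: unitary_matD)

lemma dims [simp]: "dim_row M = d" "dim_col M = d" "dim_row T = d" "dim_col T = d"
  using M_carrier T_carrier by blast+

lemma one_mult [simp]:
  "A \<in> carrier_mat d d \<Longrightarrow> 1\<^sub>m d * A = A" "A \<in> carrier_mat d d \<Longrightarrow> A * 1\<^sub>m d = (A :: complex mat)"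
  by auto

lemma assoc: "A \<in> carrier_mat d d \<Longrightarrow> B \<in> carrier_mat d d \<Longrightarrow> C \<in> carrier_mat d d \<Longrightarrow>
    A * B * C = A * (B * (C :: complex mat))"
  by (rule assoc_mult_mat)

lemma mult_carrier: "A \<in> carrier_mat d d \<Longrightarrow> B \<in> carrier_mat d d \<Longrightarrow> A * B \<in> carrier_mat d d"
  by (rule mult_carrier_mat)

lemma T_T_mult: "A \<in> carrier_mat d d \<Longrightarrow> T * (T * A) = A"
  using T_T by (simp add: assoc_mult_mat[of T d d T d A d, symmetric])

text \<open>This is \<open>T M^k T = M^(-k)\<close> stated without inverses. The induction cancels
  the innermost factors by \<open>M T M = T\<close>, which is the case \<open>k = 1\<close>
  multiplied by \<open>T\<close>.\<close>

lemma T_pow_T_pow: "(T * M ^\<^sub>m k) * (T * M ^\<^sub>m k) = 1\<^sub>m d"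
proof (induction k)
  case 0
  then show ?case using T_T by simp
next
  case (Suc k)
  have "M * (T * M) = T * ((T * M) * (T * M))"
    by (simp add: assoc mult_carrier T_T_mult)
  also have "\<dots> = T" unfolding TM_TM by simp
  finally have MTM: "M * (T * M) = T" .
  have pow: "M ^\<^sub>m Suc k = M ^\<^sub>m k * M" "M ^\<^sub>m Suc k = M * M ^\<^sub>m k"
    using mat_pow_add[OF M_carrier, of 1 k] by auto
  have "(T * M ^\<^sub>m Suc k) * (T * M ^\<^sub>m Suc k) = (T * (M ^\<^sub>m k * M)) * (T * (M * M ^\<^sub>m k))"
    using pow by metis
  also have "\<dots> = T * (M ^\<^sub>m k * ((M * (T * M)) * M ^\<^sub>m k))"
    by (simp add: assoc mult_carrier)
  also have "\<dots> = (T * M ^\<^sub>m k) * (T * M ^\<^sub>m k)"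
    unfolding MTM by (simp add: assoc mult_carrier)
  finally show ?case using Suc.IH by simp
qed

text \<open>Taking \<open>k = n\<close> in \<open>T_pow_T_pow\<close> turns both powers into the
  scalar \<open>s\<close>. A positive dimension is what makes a scalar readable from its scalar
  matrix.\<close>

lemma s_square:
  assumes "d \<ge> 1"
  shows "s * s = 1"
proof -
  have "(T * (s \<cdot>\<^sub>m 1\<^sub>m d)) * (T * (s \<cdot>\<^sub>m 1\<^sub>m d)) = (s * s) \<cdot>\<^sub>m (T * T)"
    by (simp add: mult_smult_distrib[of _ d d _ d] mult_smult_assoc_mat[of _ d d _ d] smult_smult_mat)
  then have "(s * s) \<cdot>\<^sub>m 1\<^sub>m d = 1\<^sub>m d"
    using T_pow_T_pow[of n] by (simp add: M_pow_n T_T)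
  then have "((s * s) \<cdot>\<^sub>m 1\<^sub>m d) $$ (0, 0) = 1\<^sub>m d $$ (0, 0)" by simp
  then show ?thesis using assms by simp
qed

end

text \<open>The sign is assumed and not derived from \<open>s_square\<close>, because the summand on
  the orthogonal complement may have dimension 0, where the relations say nothing about
  \<open>s\<close>.\<close>

locale dihedral_pair = twisted_dihedral_pair +
  assumes sign: "s = 1 \<or> s = -1"
begin

lemma s_s [simp]: "s * s = 1" "cnj s = s" "cmod s = 1"
  using sign by auto

lemma M_pow_add_n: "M ^\<^sub>m (n + k) = s \<cdot>\<^sub>m M ^\<^sub>m k"
  by (simp add: mat_pow_add[of _ d] M_pow_n mult_smult_assoc_mat[of _ d d _ d])

text \<open>With natural exponents the inverse of \<open>M^k\<close> is written
  \<open>s M^(n-k)\<close>, in accordance with the \<open>n - b\<close> in the product of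
  \<open>dihedral_group\<close>.\<close>

lemma T_M_pow:
  assumes "k \<le> n"
  shows "T * M ^\<^sub>m k = s \<cdot>\<^sub>m (M ^\<^sub>m (n - k) * T)"
proof -
  have "M ^\<^sub>m (n - k) * T = M ^\<^sub>m (n - k) * (T * ((T * M ^\<^sub>m k) * (T * M ^\<^sub>m k)))"
    by (simp add: T_pow_T_pow)
  also have "\<dots> = M ^\<^sub>m (n - k) * (M ^\<^sub>m k * (T * M ^\<^sub>m k))"
    by (simp add: assoc mult_carrier T_T_mult)
  also have "\<dots> = M ^\<^sub>m ((n - k) + k) * (T * M ^\<^sub>m k)"
    by (simp add: mat_pow_add[of _ d] assoc mult_carrier)
  also have "\<dots> = s \<cdot>\<^sub>m (T * M ^\<^sub>m k)"
    using assms by (simp add: M_pow_n mult_carrier mult_smult_assoc_mat[of _ d d _ d])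
  finally show ?thesis by (simp add: smult_smult_mat one_smult_mat)
qed

abbreviation "rep \<equiv> dihedral_word d M T"

lemma unitary_rep: "unitary_mat d (rep g)"
  unfolding dihedral_word_def
  by (auto intro!: unitary_mat_mult unitary_mat_pow unitary_M unitary_T unitary_mat_one)

lemma rep_carrier [simp]: "rep g \<in> carrier_mat d d"
  using unitary_rep unitary_matD(1) by blast

text \<open>The cocycle takes only the values \<open>1\<close> and \<open>s\<close>. Hence
  \<open>s = 1\<close> gives a homomorphism, and every sign gives a projective
  representation.\<close>

lemma rep_mult:
  assumes "g \<in> carrier (dihedral_group n)" "h \<in> carrier (dihedral_group n)"
  shows "\<exists>c. (c = 1 \<or> c = s) \<and> rep (g \<otimes>\<^bsub>dihedral_group n\<^esub> h) = c \<cdot>\<^sub>m (rep g * rep h)"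
proof -
  obtain a e b f where gh [simp]: "g = (a, e)" "h = (b, f)" by (cases g; cases h) blast
  have ab: "a < n" "b < n" using assms by auto
  let ?X = "\<lambda>e. if e then T else 1\<^sub>m d"
  have X: "?X e \<in> carrier_mat d d" for e by simp
  \<comment> \<open>Exponents stay below \<open>2 * n\<close>, so reducing modulo \<open>n\<close>
    removes at most one factor \<open>M^n = s\<close>.\<close>
  have red: "\<exists>c. (c = 1 \<or> c = s) \<and> M ^\<^sub>m (k mod n) = c \<cdot>\<^sub>m M ^\<^sub>m k" if k: "k < 2 * n" for k
  proof (cases "k < n")
    case True
    then show ?thesis by (intro exI[of _ 1]) (simp add: one_smult_mat)
  next
    case False
    then have "k mod n = k - n" using k by (simp add: mod_if)
    then show ?thesis
      using False M_pow_add_n[of "k - n"]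
      by (intro exI[of _ s]) (simp add: smult_smult_mat one_smult_mat)
  qed
  show ?thesis
  proof (cases e)
    case False
    obtain c where c: "c = 1 \<or> c = s" "M ^\<^sub>m ((a + b) mod n) = c \<cdot>\<^sub>m M ^\<^sub>m (a + b)"
      using red[of "a + b"] ab by auto
    have "rep (g \<otimes>\<^bsub>dihedral_group n\<^esub> h) = c \<cdot>\<^sub>m (M ^\<^sub>m (a + b) * ?X f)"
      using False c by (simp add: dihedral_word_def mult_smult_assoc_mat[of _ d d _ d])
    also have "M ^\<^sub>m (a + b) * ?X f = rep g * rep h"
      using False X[of f] by (simp add: dihedral_word_def mat_pow_add[of _ d] assoc mult_carrier)
    finally show ?thesis using c(1) by blast
  next
    case True
    obtain c where c: "c = 1 \<or> c = s" "M ^\<^sub>m ((a + (n - b)) mod n) = c \<cdot>\<^sub>m M ^\<^sub>m (a + (n - b))"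
    proof -
      have "a + (n - b) < 2 * n" using ab by linarith
      from red[OF this] that show ?thesis by blast
    qed
    have TX: "T * ?X f = ?X (\<not> f)" using T_T by simp
    define k where "k = n - b"
    have TM: "T * M ^\<^sub>m b = s \<cdot>\<^sub>m (M ^\<^sub>m k * T)"
      unfolding k_def using T_M_pow[OF less_imp_le[OF ab(2)]] .
    have "rep g * rep h = M ^\<^sub>m a * ((T * M ^\<^sub>m b) * ?X f)"
      using True X[of f] by (simp add: dihedral_word_def assoc mult_carrier)
    also have "\<dots> = s \<cdot>\<^sub>m (M ^\<^sub>m (a + k) * (T * ?X f))"
      unfolding TM using X[of f]
      by (simp add: mat_pow_add[of _ d] assoc mult_carrier mult_smult_assoc_mat[of _ d d _ d]
          mult_smult_distrib[of _ d d _ d])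
    finally have "rep g * rep h = s \<cdot>\<^sub>m (M ^\<^sub>m (a + (n - b)) * ?X (\<not> f))"
      unfolding TX k_def .
    moreover have "rep (g \<otimes>\<^bsub>dihedral_group n\<^esub> h) = c \<cdot>\<^sub>m (M ^\<^sub>m (a + (n - b)) * ?X (\<not> f))"
      using True c X[of "\<not> f"] by (simp add: dihedral_word_def mult_smult_assoc_mat[of _ d d _ d])
    \<comment> \<open>Here \<open>s\<close> comes from moving \<open>T\<close> past
      \<open>M^b\<close> and \<open>c\<close> from reducing the exponent; \<open>s * s = 1\<close>
      keeps the product in the set of \<open>1\<close> and \<open>s\<close>.\<close>
    ultimately have "rep (g \<otimes>\<^bsub>dihedral_group n\<^esub> h) = (c * s) \<cdot>\<^sub>m (rep g * rep h)"
      by (simp add: smult_smult_mat mult.assoc)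
    moreover have "c * s = 1 \<or> c * s = s" using c(1) by auto
    ultimately show ?thesis by blast
  qed
qed

lemma pow_mult_vec:
  assumes "v \<in> carrier_vec d"
  shows "M ^\<^sub>m (j + k) *\<^sub>v v = M ^\<^sub>m j *\<^sub>v (M ^\<^sub>m k *\<^sub>v v)"
  using assms by (simp add: mat_pow_add[of _ d] assoc_mult_mat_vec[of _ d d _ d])

lemma pow_vec_carrier [simp]: "v \<in> carrier_vec d \<Longrightarrow> M ^\<^sub>m k *\<^sub>v v \<in> carrier_vec d"
  by (rule mult_mat_vec_carrier[of _ d d]) auto

lemma T_vec_carrier [simp]: "v \<in> carrier_vec d \<Longrightarrow> T *\<^sub>v v \<in> carrier_vec d"
  by (rule mult_mat_vec_carrier[of _ d d]) auto

lemma pow_T_pow_T_vec: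
  assumes "v \<in> carrier_vec d"
  shows "M ^\<^sub>m k *\<^sub>v (T *\<^sub>v (M ^\<^sub>m k *\<^sub>v (T *\<^sub>v v))) = v"
proof -
  have "M ^\<^sub>m k * (T * (M ^\<^sub>m k * T)) = T * ((T * M ^\<^sub>m k) * (T * M ^\<^sub>m k)) * T"
    by (simp add: assoc mult_carrier T_T_mult)
  also have "\<dots> = 1\<^sub>m d"
    unfolding T_pow_T_pow using T_T by simp
  finally have *: "M ^\<^sub>m k * (T * (M ^\<^sub>m k * T)) = 1\<^sub>m d" .
  have "M ^\<^sub>m k *\<^sub>v (T *\<^sub>v (M ^\<^sub>m k *\<^sub>v (T *\<^sub>v v))) = (M ^\<^sub>m k * (T * (M ^\<^sub>m k * T))) *\<^sub>v v"
    using assms by (simp add: assoc_mult_mat_vec[of _ d d _ d] mult_carrier)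
  then show ?thesis
    using assms by (simp add: *)
qed

text \<open>Removing the unitary \<open>M^i\<close> from both sides leaves the exponent
  \<open>j - i\<close>; when it is negative, one period is added at the price of a factor
  \<open>s\<close>. This is the origin of the sign below the diagonal.\<close>

lemma cscalar_prod_pow:
  assumes v: "p \<in> carrier_vec d" "q \<in> carrier_vec d" and i: "i \<le> n"
  shows "(M ^\<^sub>m j *\<^sub>v p) \<bullet>c (M ^\<^sub>m i *\<^sub>v q) =
    (if i \<le> j then (M ^\<^sub>m (j - i) *\<^sub>v p) \<bullet>c q else s * ((M ^\<^sub>m (n + j - i) *\<^sub>v p) \<bullet>c q))"
proof -
  have U: "(M ^\<^sub>m i *\<^sub>v x) \<bullet>c (M ^\<^sub>m i *\<^sub>v q) = x \<bullet>c q" if "x \<in> carrier_vec d" for x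
    using unitary_mat_cscalar_prod[OF unitary_mat_pow[OF unitary_M] that v(2)] .
  show ?thesis
  proof (cases "i \<le> j")
    case True
    then show ?thesis
      using U[of "M ^\<^sub>m (j - i) *\<^sub>v p"] pow_mult_vec[OF v(1), of i "j - i"] v by simp
  next
    case False
    let ?u = "M ^\<^sub>m (n + j - i) *\<^sub>v p"
    have "M ^\<^sub>m i *\<^sub>v ?u = M ^\<^sub>m (n + j) *\<^sub>v p"
      using pow_mult_vec[OF v(1), of i "n + j - i"] i by simp
    also have "\<dots> = s \<cdot>\<^sub>v (M ^\<^sub>m j *\<^sub>v p)"
      using v by (simp add: M_pow_add_n smult_mat_mult_vec[of _ d d])
    finally have "M ^\<^sub>m j *\<^sub>v p = s \<cdot>\<^sub>v (M ^\<^sub>m i *\<^sub>v ?u)"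
      by (simp add: smult_smult_assoc)
    then have "(M ^\<^sub>m j *\<^sub>v p) \<bullet>c (M ^\<^sub>m i *\<^sub>v q) = s * ((M ^\<^sub>m i *\<^sub>v ?u) \<bullet>c (M ^\<^sub>m i *\<^sub>v q))"
      using v cscalar_prod_smult(1)[of "M ^\<^sub>m i *\<^sub>v ?u" d "M ^\<^sub>m i *\<^sub>v q" s] by simp
    then show ?thesis
      using U[of ?u] v False by simp
  qed
qed

lemma cscalar_prod_reflection_real:
  assumes v: "v \<in> carrier_vec d" and i: "i \<le> n"
  shows "(M ^\<^sub>m j *\<^sub>v (T *\<^sub>v v)) \<bullet>c (M ^\<^sub>m i *\<^sub>v v) \<in> \<real>"
proof -
  have real: "(M ^\<^sub>m k *\<^sub>v (T *\<^sub>v v)) \<bullet>c v \<in> \<real>" for k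
  proof -
    let ?u = "M ^\<^sub>m k *\<^sub>v (T *\<^sub>v v)"
    have u: "?u \<in> carrier_vec d" using v by simp
    have "?u \<bullet>c v = (M ^\<^sub>m k *\<^sub>v (T *\<^sub>v ?u)) \<bullet>c (M ^\<^sub>m k *\<^sub>v (T *\<^sub>v v))"
      using u v by (simp add: unitary_mat_cscalar_prod[OF unitary_mat_pow[OF unitary_M]]
          unitary_mat_cscalar_prod[OF unitary_T])
    also have "\<dots> = v \<bullet>c ?u"
      using pow_T_pow_T_vec[OF v] by simp
    also have "\<dots> = cnj (?u \<bullet>c v)"
      using cscalar_prod_commute[OF u v] .
    finally show ?thesis
      by (metis Reals_cnj_iff)
  qed
  have "s \<in> \<real>" using sign by auto
  then show ?thesis
    using v i real by (simp add: cscalar_prod_pow)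
qed

text \<open>The interchange of \<open>i\<close> and \<open>j\<close> is what makes the lower right
  block the transpose of the upper left one.\<close>

lemma cscalar_prod_reflection_reflection:
  assumes v: "v \<in> carrier_vec d"
  shows "(M ^\<^sub>m j *\<^sub>v (T *\<^sub>v v)) \<bullet>c (M ^\<^sub>m i *\<^sub>v (T *\<^sub>v v)) = (M ^\<^sub>m i *\<^sub>v v) \<bullet>c (M ^\<^sub>m j *\<^sub>v v)"
proof -
  let ?x = "\<lambda>j. M ^\<^sub>m j *\<^sub>v (T *\<^sub>v v)"
  have x: "?x j \<in> carrier_vec d" "T *\<^sub>v ?x j \<in> carrier_vec d" for j using v by auto
  have "?x j \<bullet>c ?x i = (T *\<^sub>v ?x j) \<bullet>c (T *\<^sub>v ?x i)"
    using unitary_mat_cscalar_prod[OF unitary_T x(1) x(1)] by simp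
  \<comment> \<open>The common exponent \<open>i + j\<close> leaves, next to each vector, a factor
    of the form \<open>M^k T M^k T = 1\<close>, with \<open>k = j\<close> on the left and
    \<open>k = i\<close> on the right.\<close>
  also have "\<dots> = (M ^\<^sub>m (i + j) *\<^sub>v (T *\<^sub>v ?x j)) \<bullet>c (M ^\<^sub>m (j + i) *\<^sub>v (T *\<^sub>v ?x i))"
    using unitary_mat_cscalar_prod[OF unitary_mat_pow[OF unitary_M] x(2) x(2)] by (simp add: add.commute)
  also have "\<dots> = (M ^\<^sub>m i *\<^sub>v v) \<bullet>c (M ^\<^sub>m j *\<^sub>v v)"
    unfolding pow_mult_vec[OF x(2)] pow_T_pow_T_vec[OF v] ..
  finally show ?thesis .
qed

text \<open>For \<open>J = M\<^bsup>n div 2\<^esup>\<close> the relations give \<open>J J = -1\<close> and \<open>T J T = -J\<close>; compare determinants.\<close>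

lemma even_dimension:
  assumes s: "s = -1" and n: "even n"
  shows "even d"
proof -
  define J where "J = M ^\<^sub>m (n div 2)"
  have J: "J \<in> carrier_mat d d" by (simp add: J_def)
  have "n = n div 2 + n div 2" using n by auto
  then have JJ: "J * J = (-1) \<cdot>\<^sub>m 1\<^sub>m d"
    unfolding J_def by (metis M_carrier M_pow_n mat_pow_add s)
  have TJ: "(T * J) * (T * J) = 1\<^sub>m d"
    unfolding J_def by (rule T_pow_T_pow)
  have "J = ((T * J) * (T * J)) * J"
    unfolding TJ using J by simp
  also have "\<dots> = (T * J) * (T * (J * J))"
    using J by (simp add: assoc mult_carrier)
  also have "\<dots> = (-1) \<cdot>\<^sub>m ((T * J) * T)"
    unfolding JJ using J by (simp add: mult_carrier mult_smult_distrib[of _ d d _ d])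
  finally have "det J = (-1) ^ d * (det T * det J * det T)"
    using J det_smult[of "-1" "(T * J) * T"] by (simp add: det_mult[of _ d] mult_carrier)
  also have "\<dots> = (-1) ^ d * det J * det (T * T)"
    by (simp add: det_mult[of _ d])
  finally have "det J = (-1) ^ d * det J"
    unfolding T_T by simp
  moreover have "det J \<noteq> 0"
  proof
    assume "det J = 0"
    then have "det ((T * J) * (T * J)) = 0" using J by (simp add: det_mult[of _ d] mult_carrier)
    then show False unfolding TJ by simp
  qed
  ultimately show ?thesis
    by (cases "even d") auto
qed

context
  fixes U :: "complex mat"
  assumes U: "unitary_mat d U"
begin

lemma conj_carrier: "U \<in> carrier_mat d d" "mat_adjoint U \<in> carrier_mat d d"
  using unitary_matD(1)[OF U] by simp_all

lemma conj_mult: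
  assumes A: "A \<in> carrier_mat d d" and B: "B \<in> carrier_mat d d"
  shows "(U * (A * mat_adjoint U)) * (U * (B * mat_adjoint U)) = U * ((A * B) * mat_adjoint U)"
proof -
  note [simp] = conj_carrier
  have "(U * (A * mat_adjoint U)) * (U * (B * mat_adjoint U)) =
      U * (A * ((mat_adjoint U * U) * (B * mat_adjoint U)))"
    using A B by (simp add: assoc mult_carrier)
  then show ?thesis
    using A B unitary_matD(2)[OF U] by (simp add: assoc mult_carrier)
qed

lemma conj_one: "U * (1\<^sub>m d * mat_adjoint U) = 1\<^sub>m d"
  using conj_carrier unitary_matD(3)[OF U] by simp

lemma conj_pow: "(U * (M * mat_adjoint U)) ^\<^sub>m k = U * (M ^\<^sub>m k * mat_adjoint U)"
proof (induction k)
  case 0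
  then show ?case using conj_carrier conj_one by simp
next
  case (Suc k)
  then show ?case using conj_mult[of "M ^\<^sub>m k" M] by simp
qed

text \<open>Used twice: to undo an equivalence of representations, and to return from coordinates
  adapted to the span of a family to the original ones.\<close>

lemma conj_unitary: "dihedral_pair d n s (U * (M * mat_adjoint U)) (U * (T * mat_adjoint U))"
proof
  have one: "U * ((c \<cdot>\<^sub>m 1\<^sub>m d) * mat_adjoint U) = c \<cdot>\<^sub>m 1\<^sub>m d" for c
    using conj_carrier unitary_matD(3)[OF U]
    by (simp add: mult_smult_assoc_mat[of _ d d _ d] mult_smult_distrib[of _ d d _ d])
  show "unitary_mat d (U * (M * mat_adjoint U))" "unitary_mat d (U * (T * mat_adjoint U))"
    by (intro unitary_mat_mult unitary_mat_adjoint U unitary_M unitary_T)+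
  show "U * (T * mat_adjoint U) * (U * (T * mat_adjoint U)) = 1\<^sub>m d"
    using conj_mult[of T T] T_T conj_one by simp
  show "U * (T * mat_adjoint U) * (U * (M * mat_adjoint U)) *
      (U * (T * mat_adjoint U) * (U * (M * mat_adjoint U))) = 1\<^sub>m d"
    unfolding conj_mult[OF T_carrier M_carrier]
    using conj_mult[of "T * M" "T * M"] TM_TM conj_one by (simp add: mult_carrier)
  show "(U * (M * mat_adjoint U)) ^\<^sub>m n = s \<cdot>\<^sub>m 1\<^sub>m d"
    unfolding conj_pow M_pow_n by (rule one)
qed (rule sign)

lemma conj_word:
  "dihedral_word d (U * (M * mat_adjoint U)) (U * (T * mat_adjoint U)) g =
    U * (rep g * mat_adjoint U)"
  using conj_mult[of "M ^\<^sub>m fst g" "if snd g then T else 1\<^sub>m d"] conj_one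
  by (auto simp: dihedral_word_def conj_pow)

end

end

lemma dihedral_pair_direct_sum:
  assumes "dihedral_pair r n s M1 T1" "dihedral_pair m n s M2 T2"
  shows "dihedral_pair (r + m) n s (direct_sum M1 M2) (direct_sum T1 T2)"
proof -
  interpret p1: dihedral_pair r n s M1 T1 by fact
  interpret p2: dihedral_pair m n s M2 T2 by fact
  show ?thesis
  proof
    show "unitary_mat (r + m) (direct_sum M1 M2)" "unitary_mat (r + m) (direct_sum T1 T2)"
      by (intro unitary_direct_sum p1.unitary_M p2.unitary_M p1.unitary_T p2.unitary_T)+
    show "direct_sum T1 T2 * direct_sum T1 T2 = 1\<^sub>m (r + m)"
      by (simp add: direct_sum_mult[of _ r _ m] p1.T_T p2.T_T direct_sum_one)
    show "direct_sum T1 T2 * direct_sum M1 M2 * (direct_sum T1 T2 * direct_sum M1 M2) = 1\<^sub>m (r + m)"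
      by (simp add: direct_sum_mult[of _ r _ m] p1.mult_carrier p2.mult_carrier p1.TM_TM p2.TM_TM
          direct_sum_one)
    show "direct_sum M1 M2 ^\<^sub>m n = s \<cdot>\<^sub>m 1\<^sub>m (r + m)"
      by (simp add: direct_sum_pow[of _ r _ m] p1.M_pow_n p2.M_pow_n direct_sum_smult[of _ r _ m]
          direct_sum_one)
  qed (rule p1.sign)
qed

lemma dihedral_word_direct_sum:
  assumes "M1 \<in> carrier_mat r r" "T1 \<in> carrier_mat r r" "M2 \<in> carrier_mat m m" "T2 \<in> carrier_mat m m"
  shows "dihedral_word (r + m) (direct_sum M1 M2) (direct_sum T1 T2) g =
    direct_sum (dihedral_word r M1 T1 g) (dihedral_word m M2 T2 g)"
  using assms direct_sum_mult[of "M1 ^\<^sub>m fst g" r "M2 ^\<^sub>m fst g" m "1\<^sub>m r" "1\<^sub>m m"]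
  by (auto simp: dihedral_word_def direct_sum_pow[of _ r _ m] direct_sum_mult[of _ r _ m]
      direct_sum_one)

lemma smult_one_mat_mult: "(c \<cdot>\<^sub>m 1\<^sub>m d) * (e \<cdot>\<^sub>m 1\<^sub>m d) = (c * e :: complex) \<cdot>\<^sub>m 1\<^sub>m d"
  by (simp add: mult_smult_assoc_mat[of _ d d _ d] smult_smult_mat)

lemma smult_one_mat_pow: "(c \<cdot>\<^sub>m 1\<^sub>m d) ^\<^sub>m k = (c ^ k :: complex) \<cdot>\<^sub>m 1\<^sub>m d"
  by (induction k) (simp_all add: one_smult_mat smult_one_mat_mult mult.commute)

text \<open>The converse of \<open>even_dimension\<close>: the parity condition found there is the
  only restriction on the dimension.\<close>

lemma dihedral_pair_exists:
  assumes sign: "s = 1 \<or> s = -1" and par: "s = -1 \<Longrightarrow> even n \<Longrightarrow> even m" and n: "n \<ge> 1"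
  shows "\<exists>M T. dihedral_pair m n s M T"
proof (cases "s = -1 \<and> even n")
  case False
  \<comment> \<open>Outside the excluded case \<open>s = 1\<close> or \<open>n\<close> is odd, so
    the scalar matrix of \<open>s\<close> already has the right \<open>n\<close>-th power.\<close>
  have "s ^ n = s" using False sign by auto
  then have "dihedral_pair m n s (s \<cdot>\<^sub>m 1\<^sub>m m) (1\<^sub>m m)"
    using sign by unfold_locales
      (auto simp: smult_one_mat_mult smult_one_mat_pow one_smult_mat
        intro!: unitary_mat_smult unitary_mat_one)
  then show ?thesis by blast
next
  case True
  then obtain k where k: "m = k + k" using par by (metis evenE mult_2)
  \<comment> \<open>A unimodular \<open>n\<close>-th root of \<open>-1\<close>. Its inverse is
    \<open>cnj z\<close>, so interchanging the eigenspaces of \<open>z\<close> and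
    \<open>cnj z\<close> inverts \<open>M\<close>.\<close>
  define z where "z = cis (pi / n)"
  have z: "z ^ n = -1" "cmod z = 1" "cnj z * z = 1"
    using n by (simp_all add: z_def DeMoivre cis_cnj cis_mult)
  let ?M = "direct_sum (z \<cdot>\<^sub>m 1\<^sub>m k) (cnj z \<cdot>\<^sub>m 1\<^sub>m k)"
  let ?T = "four_block_mat (0\<^sub>m k k) (1\<^sub>m k) (1\<^sub>m k) (0\<^sub>m k k) :: complex mat"
  have M: "?M \<in> carrier_mat (k + k) (k + k)" and T: "?T \<in> carrier_mat (k + k) (k + k)"
    by auto
  have TT: "?T * ?T = 1\<^sub>m (k + k)"
    by (subst mult_four_block_mat[of _ k k _ k _ k _ _ k _ k]) auto
  have TM: "?T * ?M = four_block_mat (0\<^sub>m k k) (cnj z \<cdot>\<^sub>m 1\<^sub>m k) (z \<cdot>\<^sub>m 1\<^sub>m k) (0\<^sub>m k k)"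
    unfolding direct_sum_def
    by (subst mult_four_block_mat[of _ k k _ k _ k _ _ k _ k]) auto
  have "dihedral_pair m n s ?M ?T"
    unfolding k
  proof
    show "unitary_mat (k + k) ?M"
      using z by (intro unitary_direct_sum unitary_mat_smult unitary_mat_one) auto
    have "mat_adjoint ?T = ?T"
      by (rule eq_matI) auto
    then show "unitary_mat (k + k) ?T" using T TT by (simp add: unitary_mat_def)
    show "?T * ?T = 1\<^sub>m (k + k)" by (rule TT)
    show "?T * ?M * (?T * ?M) = 1\<^sub>m (k + k)"
      unfolding TM using z
      by (subst mult_four_block_mat[of _ k k _ k _ k _ _ k _ k])
        (auto simp: smult_one_mat_mult mult.commute one_smult_mat)
    have "cnj z ^ n = -1" using z by (metis complex_cnj_minus complex_cnj_one complex_cnj_power)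
    then show "?M ^\<^sub>m n = s \<cdot>\<^sub>m 1\<^sub>m (k + k)"
      using z True by (simp add: direct_sum_pow[of _ k _ k] smult_one_mat_pow
          direct_sum_smult[of _ k _ k] direct_sum_one)
  qed (use sign in auto)
  then show ?thesis by blast
qed

section \<open>Projective representations of the dihedral group\<close>

definition proj_eq :: "complex mat \<Rightarrow> complex mat \<Rightarrow> bool" where
  "proj_eq A B \<longleftrightarrow> (\<exists>c. cmod c = 1 \<and> A = c \<cdot>\<^sub>m B)"

lemma proj_eq_refl: "proj_eq A A"
  unfolding proj_eq_def by (rule exI[of _ 1]) (simp add: one_smult_mat)

lemma proj_eq_sym: "proj_eq A B \<Longrightarrow> proj_eq B A"
proof -
  assume "proj_eq A B"
  then obtain c where c: "cmod c = 1" "A = c \<cdot>\<^sub>m B" by (auto simp: proj_eq_def)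
  then have "c \<noteq> 0" by auto
  then have "B = inverse c \<cdot>\<^sub>m A" "cmod (inverse c) = 1"
    using c by (auto simp: smult_smult_mat one_smult_mat norm_inverse)
  then show ?thesis by (auto simp: proj_eq_def)
qed

lemma proj_eq_trans [trans]: "proj_eq A B \<Longrightarrow> proj_eq B C \<Longrightarrow> proj_eq A C"
  unfolding proj_eq_def by (metis norm_mult mult_1 smult_smult_mat)

lemma proj_eq_mult:
  assumes "proj_eq A A'" "proj_eq B B'" "A' \<in> carrier_mat d d" "B' \<in> carrier_mat d d"
  shows "proj_eq (A * B) (A' * B')"
proof -
  obtain c c' where "cmod c = 1" "A = c \<cdot>\<^sub>m A'" "cmod c' = 1" "B = c' \<cdot>\<^sub>m B'"
    using assms(1,2) by (auto simp: proj_eq_def)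
  then have "A * B = (c * c') \<cdot>\<^sub>m (A' * B')" "cmod (c * c') = 1"
    using assms(3,4) by (simp_all add: norm_mult mult_smult_distrib[of _ d d _ d]
        mult_smult_assoc_mat[of _ d d _ d] smult_smult_mat mult.commute)
  then show ?thesis by (auto simp: proj_eq_def)
qed

lemma proj_eq_smult: "cmod c = 1 \<Longrightarrow> proj_eq (c \<cdot>\<^sub>m A) A"
  by (auto simp: proj_eq_def)

text \<open>A projective representation need not send the identity to \<open>1\<close>; cancelling
  one unitary factor in \<open>\<pi>(1) = c \<pi>(1) \<pi>(1)\<close> shows that its value is at
  least a scalar.\<close>

lemma projective_rep_one:
  assumes n: "n \<ge> 1" and \<pi>: "projective_rep (dihedral_group n) d \<pi>"
  shows "proj_eq (1\<^sub>m d) (\<pi> (0, False))"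
proof -
  have U: "unitary_mat d (\<pi> (0, False))"
    using \<pi> n by (auto simp: projective_rep_def)
  note Uc = unitary_matD[OF U]
  have "(0, False) \<in> carrier (dihedral_group n)" using n by simp
  then obtain c where c: "cmod c = 1" "\<pi> (0, False) = c \<cdot>\<^sub>m (\<pi> (0, False) * \<pi> (0, False))"
    using \<pi> n unfolding projective_rep_def by fastforce
  have "1\<^sub>m d = mat_adjoint (\<pi> (0, False)) * \<pi> (0, False)"
    using Uc by simp
  also have "\<dots> = mat_adjoint (\<pi> (0, False)) * (c \<cdot>\<^sub>m (\<pi> (0, False) * \<pi> (0, False)))"
    using c(2) by simp
  also have "\<dots> = c \<cdot>\<^sub>m ((mat_adjoint (\<pi> (0, False)) * \<pi> (0, False)) * \<pi> (0, False))"
    using Uc(1) mult_carrier_mat[OF Uc(1) Uc(1)]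
    by (simp add: mult_smult_distrib[of _ d d _ d] assoc_mult_mat[of _ d d _ d _ d])
  also have "\<dots> = c \<cdot>\<^sub>m \<pi> (0, False)"
    using Uc by simp
  finally show ?thesis using c(1) by (auto simp: proj_eq_def)
qed

text \<open>Since \<open>k\<close> is arbitrary, the case \<open>k = n\<close> also shows that the
  \<open>n\<close>-th power of \<open>\<pi>(\<mu>)\<close> is a scalar.\<close>

lemma projective_rep_proj_eq_word:
  assumes n: "n \<ge> 1" and \<pi>: "projective_rep (dihedral_group n) d \<pi>"
  shows "proj_eq (\<pi> (k mod n, e)) (dihedral_word d (\<pi> (dihedral_mu n)) (\<pi> dihedral_tau) (k, e))"
proof -
  let ?G = "dihedral_group n"
  have mul: "proj_eq (\<pi> (g \<otimes>\<^bsub>?G\<^esub> h)) (\<pi> g * \<pi> h)" and car: "\<pi> g \<in> carrier_mat d d"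
    if "g \<in> carrier ?G" "h \<in> carrier ?G" for g h
    using \<pi> that unfolding projective_rep_def proj_eq_def by (auto dest: unitary_matD(1))
  have mu: "dihedral_mu n \<in> carrier ?G" and tau: "dihedral_tau \<in> carrier ?G"
    using n by (auto simp: dihedral_mu_def dihedral_tau_def)
  have Mc: "\<pi> (dihedral_mu n) \<in> carrier_mat d d" and Tc: "\<pi> dihedral_tau \<in> carrier_mat d d"
    using car mu tau by auto
  have pow: "proj_eq (\<pi> (k mod n, False)) (\<pi> (dihedral_mu n) ^\<^sub>m k)" for k
  proof (induction k)
    case 0
    then show ?case
      using proj_eq_sym[OF projective_rep_one[OF n \<pi>]] Mc by simp
  next
    case (Suc k)
    have "(Suc k mod n, False) = (k mod n, False) \<otimes>\<^bsub>?G\<^esub> dihedral_mu n"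
      by (simp add: dihedral_mu_def mod_simps)
    also have "proj_eq (\<pi> \<dots>) (\<pi> (k mod n, False) * \<pi> (dihedral_mu n))"
      using mu n by (intro mul) auto
    also have "proj_eq \<dots> (\<pi> (dihedral_mu n) ^\<^sub>m k * \<pi> (dihedral_mu n))"
      using Mc by (intro proj_eq_mult[OF Suc.IH proj_eq_refl, where d = d]) auto
    finally show ?case by simp
  qed
  show ?thesis
  proof (cases e)
    case False
    then show ?thesis
      using pow[of k] Mc right_mult_one_mat[OF pow_carrier_mat[OF Mc, of k]]
      by (simp add: dihedral_word_def)
  next
    case True
    have "(k mod n, e) = (k mod n, False) \<otimes>\<^bsub>?G\<^esub> dihedral_tau"
      using True by (simp add: dihedral_tau_def)
    also have "proj_eq (\<pi> \<dots>) (\<pi> (k mod n, False) * \<pi> dihedral_tau)"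
      using tau n by (intro mul) auto
    also have "proj_eq \<dots> (\<pi> (dihedral_mu n) ^\<^sub>m k * \<pi> dihedral_tau)"
      using Mc Tc by (intro proj_eq_mult[OF pow proj_eq_refl, where d = d]) auto
    finally show ?thesis using True by (simp add: dihedral_word_def)
  qed
qed

text \<open>The words are compared with \<open>\<pi>\<close> up to a phase for each group element:
  such phases change neither the orbit up to switching nor the type of \<open>\<pi>\<close>.\<close>

definition realizes ::
  "nat \<Rightarrow> nat \<Rightarrow> complex \<Rightarrow> complex mat \<Rightarrow> complex mat \<Rightarrow> (nat \<times> bool \<Rightarrow> complex mat) \<Rightarrow> bool" where
  "realizes d n s M T \<pi> \<longleftrightarrow> dihedral_pair d n s M T \<and>
     (\<forall>g\<in>carrier (dihedral_group n). proj_eq (\<pi> g) (dihedral_word d M T g))"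

lemma dihedral_word_smult:
  assumes "M \<in> carrier_mat d d" "T \<in> carrier_mat d d" "cmod a = 1" "cmod b = 1"
  shows "proj_eq (dihedral_word d (a \<cdot>\<^sub>m M) (b \<cdot>\<^sub>m T) g) (dihedral_word d M T g)"
proof -
  have pow: "proj_eq ((a \<cdot>\<^sub>m M) ^\<^sub>m k) (M ^\<^sub>m k)" for k
  proof (induction k)
    case 0
    then show ?case using assms by (simp add: proj_eq_refl)
  next
    case (Suc k)
    then show ?case
      using assms by (auto intro!: proj_eq_mult[of _ _ _ _ d] proj_eq_smult)
  qed
  show ?thesis
    unfolding dihedral_word_def
    using assms by (intro proj_eq_mult[OF pow, where d = d]) (auto intro: proj_eq_smult proj_eq_refl)
qed

text \<open>The unscaled generators satisfy the three relations up to scalars \<open>c1\<close>,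
  \<open>c2\<close>, \<open>c3\<close>. The two free phases \<open>t\<close> and \<open>m\<close>
  remove \<open>c1\<close> and \<open>c2\<close>; what then remains in the third relation,
  \<open>m ^ n * c3\<close>, is a sign by \<open>s_square\<close>.\<close>

lemma projective_rep_realized:
  assumes n: "n \<ge> 1" and d: "d \<ge> 1" and \<pi>: "projective_rep (dihedral_group n) d \<pi>"
  shows "\<exists>s M T. realizes d n s M T \<pi>"
proof -
  let ?G = "dihedral_group n"
  define M0 where "M0 = \<pi> (dihedral_mu n)"
  define T0 where "T0 = \<pi> dihedral_tau"
  have mu: "dihedral_mu n \<in> carrier ?G" and tau: "dihedral_tau \<in> carrier ?G"
    using n by (auto simp: dihedral_mu_def dihedral_tau_def)
  have U: "unitary_mat d M0" "unitary_mat d T0"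
    using \<pi> mu tau unfolding projective_rep_def M0_def T0_def by blast+
  note c = unitary_matD(1)[OF U(1)] unitary_matD(1)[OF U(2)]
  have mul: "proj_eq (\<pi> (g \<otimes>\<^bsub>?G\<^esub> h)) (\<pi> g * \<pi> h)"
    if "g \<in> carrier ?G" "h \<in> carrier ?G" for g h
    using \<pi> that unfolding projective_rep_def proj_eq_def by auto
  note one = proj_eq_sym[OF projective_rep_one[OF n \<pi>]]
  note w = projective_rep_proj_eq_word[OF n \<pi>, folded M0_def T0_def]
  have "proj_eq (T0 * T0) (\<pi> (dihedral_tau \<otimes>\<^bsub>?G\<^esub> dihedral_tau))"
    unfolding T0_def by (rule proj_eq_sym[OF mul[OF tau tau]])
  also have "dihedral_tau \<otimes>\<^bsub>?G\<^esub> dihedral_tau = (0, False)"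
    by (simp add: dihedral_tau_def)
  also note one
  finally obtain c1 where c1: "cmod c1 = 1" "T0 * T0 = c1 \<cdot>\<^sub>m 1\<^sub>m d"
    by (auto simp: proj_eq_def)
  let ?tm = "dihedral_tau \<otimes>\<^bsub>?G\<^esub> dihedral_mu n"
  have tm: "?tm \<in> carrier ?G" "?tm \<otimes>\<^bsub>?G\<^esub> ?tm = (0, False)"
    using n by (auto simp: dihedral_mu_def dihedral_tau_def)
  have tmc: "\<pi> ?tm \<in> carrier_mat d d"
    using \<pi> tm(1) unfolding projective_rep_def by (blast dest: unitary_matD(1))
  have "proj_eq (T0 * M0) (\<pi> ?tm)"
    unfolding T0_def M0_def by (rule proj_eq_sym[OF mul[OF tau mu]])
  then have "proj_eq ((T0 * M0) * (T0 * M0)) (\<pi> ?tm * \<pi> ?tm)"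
    using tmc by (intro proj_eq_mult)
  also have "proj_eq (\<pi> ?tm * \<pi> ?tm) (\<pi> (?tm \<otimes>\<^bsub>?G\<^esub> ?tm))"
    by (rule proj_eq_sym[OF mul[OF tm(1) tm(1)]])
  also note tm(2)
  also note one
  finally obtain c2 where c2: "cmod c2 = 1" "(T0 * M0) * (T0 * M0) = c2 \<cdot>\<^sub>m 1\<^sub>m d"
    by (auto simp: proj_eq_def)
  have "proj_eq (M0 ^\<^sub>m n) (\<pi> (n mod n, False))"
    using proj_eq_sym[OF w[of n False]] right_mult_one_mat[OF pow_carrier_mat[OF c(1), of n]]
    by (simp add: dihedral_word_def)
  also have "(n mod n, False) = (0, False)" by simp
  also note one
  finally obtain c3 where c3: "cmod c3 = 1" "M0 ^\<^sub>m n = c3 \<cdot>\<^sub>m 1\<^sub>m d"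
    by (auto simp: proj_eq_def)
  \<comment> \<open>Chosen so that \<open>t * t * c1 = 1\<close>.\<close>
  define t where "t = inverse (csqrt c1)"
  have t: "cmod t = 1" "t * t * c1 = 1"
  proof -
    have "csqrt c1 * csqrt c1 = c1" by (metis power2_csqrt power2_eq_square)
    then show "t * t * c1 = 1" using c1(1) by (auto simp: t_def field_simps)
    show "cmod t = 1" using c1(1) by (simp add: t_def norm_inverse)
  qed
  \<comment> \<open>Chosen after \<open>t\<close>, so that the factor \<open>t * m\<close> of the
    product of the two generators has square inverse to \<open>c2\<close>.\<close>
  define m where "m = inverse (t * csqrt c2)"
  have m: "cmod m = 1" "t * m * (t * m) * c2 = 1"
  proof -
    have "csqrt c2 * csqrt c2 = c2" by (metis power2_csqrt power2_eq_square)
    moreover have "t \<noteq> 0" "c2 \<noteq> 0" using t(1) c2(1) by auto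
    moreover from this have "t * m = inverse (csqrt c2)" by (simp add: m_def)
    ultimately show "t * m * (t * m) * c2 = 1"
      by (metis nonzero_inverse_mult_distrib csqrt_eq_0 left_inverse)
    show "cmod m = 1" using c2(1) t(1) by (simp add: m_def norm_inverse norm_mult)
  qed
  define M where "M = m \<cdot>\<^sub>m M0"
  define T where "T = t \<cdot>\<^sub>m T0"
  have TM: "T * M = (t * m) \<cdot>\<^sub>m (T0 * M0)"
    using c by (simp add: T_def M_def mult_smult_distrib[of _ d d _ d]
        mult_smult_assoc_mat[of _ d d _ d] smult_smult_mat mult.commute)
  have pow: "M ^\<^sub>m k = m ^ k \<cdot>\<^sub>m M0 ^\<^sub>m k" for k
  proof (induction k)
    case 0
    then show ?case using c by (simp add: M_def one_smult_mat)
  next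
    case (Suc k)
    then show ?case
      using c by (simp add: M_def mult_smult_distrib[of _ d d _ d]
        mult_smult_assoc_mat[of _ d d _ d] smult_smult_mat mult.commute)
  qed
  interpret twisted_dihedral_pair d n "m ^ n * c3" M T
  proof
    show "unitary_mat d M" "unitary_mat d T"
      using U m(1) t(1) by (auto simp: M_def T_def intro: unitary_mat_smult)
    have "T * T = (t * t) \<cdot>\<^sub>m (T0 * T0)"
      using c by (simp add: T_def mult_smult_distrib[of _ d d _ d]
        mult_smult_assoc_mat[of _ d d _ d] smult_smult_mat)
    then show "T * T = 1\<^sub>m d"
      using t by (simp add: c1 smult_smult_mat one_smult_mat)
    have "T * M * (T * M) = (t * m * (t * m)) \<cdot>\<^sub>m ((T0 * M0) * (T0 * M0))"
      using mult_carrier_mat[OF c(2,1)] unfolding TM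
      by (simp add: mult_smult_distrib[of _ d d _ d]
        mult_smult_assoc_mat[of _ d d _ d] smult_smult_mat)
    then show "T * M * (T * M) = 1\<^sub>m d"
      using m by (simp add: c2 smult_smult_mat one_smult_mat)
    show "M ^\<^sub>m n = (m ^ n * c3) \<cdot>\<^sub>m 1\<^sub>m d"
      by (simp add: pow c3 smult_smult_mat)
  qed
  have "dihedral_pair d n (m ^ n * c3) M T"
    by unfold_locales (use s_square[OF d] in \<open>simp add: square_eq_1_iff\<close>)
  moreover have "proj_eq (\<pi> g) (dihedral_word d M T g)" if "g \<in> carrier ?G" for g
  proof -
    obtain k e where [simp]: "g = (k, e)" by (cases g)
    have "proj_eq (\<pi> g) (dihedral_word d M0 T0 g)"
      using w[of k e] that by simp
    also have "proj_eq (dihedral_word d M0 T0 g) (dihedral_word d M T g)"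
      unfolding M_def T_def by (rule proj_eq_sym[OF dihedral_word_smult[OF c m(1) t(1)]])
    finally show ?thesis .
  qed
  ultimately show ?thesis unfolding realizes_def by blast
qed

lemma dihedral_pair_strict_rep:
  assumes n: "n \<ge> 1" and "dihedral_pair d n 1 M T"
  shows "strict_rep (dihedral_group n) d (dihedral_word d M T)"
proof -
  interpret dihedral_pair d n 1 M T by fact
  have "rep (g \<otimes>\<^bsub>dihedral_group n\<^esub> h) = rep g * rep h"
    if "g \<in> carrier (dihedral_group n)" "h \<in> carrier (dihedral_group n)" for g h
    using rep_mult[OF that] by (auto simp: one_smult_mat)
  then show ?thesis
    unfolding strict_rep_def projective_rep_def
    using unitary_rep one_smult_mat by (metis norm_one)
qed

lemma dihedral_pair_projective_rep:
  assumes "dihedral_pair d n s M T"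
    and \<pi>: "\<And>g. g \<in> carrier (dihedral_group n) \<Longrightarrow> proj_eq (\<pi> g) (dihedral_word d M T g)"
    and n: "n \<ge> 1"
  shows "projective_rep (dihedral_group n) d \<pi>"
proof -
  interpret dihedral_pair d n s M T by fact
  let ?G = "dihedral_group n"
  interpret G: group ?G using n by (rule group_dihedral_group)
  have "unitary_mat d (\<pi> g)" if "g \<in> carrier ?G" for g
    using \<pi>[OF that] unitary_rep unitary_mat_smult unfolding proj_eq_def by metis
  moreover have "proj_eq (\<pi> (g \<otimes>\<^bsub>?G\<^esub> h)) (\<pi> g * \<pi> h)" if gh: "g \<in> carrier ?G" "h \<in> carrier ?G" for g h
  proof -
    have "proj_eq (\<pi> (g \<otimes>\<^bsub>?G\<^esub> h)) (rep (g \<otimes>\<^bsub>?G\<^esub> h))"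
      using gh by (intro \<pi> G.m_closed)
    also have "proj_eq \<dots> (rep g * rep h)"
      using rep_mult[OF gh] s_s(3) unfolding proj_eq_def by (metis norm_one)
    also have "proj_eq (rep g * rep h) (\<pi> g * \<pi> h)"
      using gh by (intro proj_eq_sym[OF proj_eq_mult[of _ _ _ _ d]] \<pi>) auto
    finally show ?thesis .
  qed
  ultimately show ?thesis
    unfolding projective_rep_def proj_eq_def by blast
qed

text \<open>A homomorphism satisfies the relations exactly, so the generators of
  \<open>\<rho>\<close> form a pair with \<open>s = 1\<close>; conjugating it back along the
  equivalence gives a pair for \<open>\<pi>\<close>.\<close>

lemma strict_type_realized:
  assumes n: "n \<ge> 1" and st: "strict_type (dihedral_group n) d \<pi>"
    and \<pi>: "\<And>g. g \<in> carrier (dihedral_group n) \<Longrightarrow> \<pi> g \<in> carrier_mat d d"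
  shows "\<exists>M T. realizes d n 1 M T \<pi>"
proof -
  let ?G = "dihedral_group n"
  obtain \<rho> Q where \<rho>: "strict_rep ?G d \<rho>" and Q: "unitary_mat d Q"
    and eq: "\<And>g. g \<in> carrier ?G \<Longrightarrow> proj_eq (Q * \<pi> g * mat_adjoint Q) (\<rho> g)"
    using st unfolding strict_type_def equivalent_reps_def proj_eq_def by blast
  have mul: "\<rho> (g \<otimes>\<^bsub>?G\<^esub> h) = \<rho> g * \<rho> h" and U: "unitary_mat d (\<rho> g)"
    if "g \<in> carrier ?G" "h \<in> carrier ?G" for g h
    using \<rho> that unfolding strict_rep_def projective_rep_def by blast+
  have z: "(0, False) \<in> carrier ?G" using n by simp
  note U0 = unitary_matD[OF U[OF z z]]
  have one: "\<rho> (0, False) = 1\<^sub>m d"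
  proof -
    have "\<rho> (0, False) * \<rho> (0, False) = \<rho> (0, False)"
      using mul[OF z z] by simp
    then have "mat_adjoint (\<rho> (0, False)) * (\<rho> (0, False) * \<rho> (0, False)) = 1\<^sub>m d"
      using U0 by simp
    then show ?thesis
      using U0 by (simp flip: assoc_mult_mat[of _ d d _ d _ d])
  qed
  define M where "M = \<rho> (dihedral_mu n)"
  define T where "T = \<rho> dihedral_tau"
  have mu: "dihedral_mu n \<in> carrier ?G" and tau: "dihedral_tau \<in> carrier ?G"
    using n by (auto simp: dihedral_mu_def dihedral_tau_def)
  have UM: "unitary_mat d M" "unitary_mat d T"
    using U mu tau by (auto simp: M_def T_def)
  note c = unitary_matD(1)[OF UM(1)] unitary_matD(1)[OF UM(2)]
  have pow: "M ^\<^sub>m k = \<rho> (k mod n, False)" for k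
  proof (induction k)
    case 0
    then show ?case using one c by simp
  next
    case (Suc k)
    have "(Suc k mod n, False) = (k mod n, False) \<otimes>\<^bsub>?G\<^esub> dihedral_mu n"
      by (simp add: dihedral_mu_def mod_simps)
    then show ?case
      using Suc mul[of "(k mod n, False)" "dihedral_mu n"] mu n by (simp add: M_def)
  qed
  interpret dihedral_pair d n 1 M T
  proof
    show "unitary_mat d M" "unitary_mat d T" by fact+
    have "\<rho> (dihedral_tau \<otimes>\<^bsub>?G\<^esub> dihedral_tau) = T * T"
      unfolding T_def by (rule mul[OF tau tau])
    moreover have "dihedral_tau \<otimes>\<^bsub>?G\<^esub> dihedral_tau = (0, False)"
      by (simp add: dihedral_tau_def)
    ultimately show "T * T = 1\<^sub>m d" using one by simp
    let ?tm = "dihedral_tau \<otimes>\<^bsub>?G\<^esub> dihedral_mu n"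
    have tm: "?tm \<in> carrier ?G" "?tm \<otimes>\<^bsub>?G\<^esub> ?tm = (0, False)"
      using n by (auto simp: dihedral_mu_def dihedral_tau_def)
    show "T * M * (T * M) = 1\<^sub>m d"
      using mul[OF tm(1) tm(1)] mul[OF tau mu] tm(2) one by (simp add: T_def M_def)
    show "M ^\<^sub>m n = 1 \<cdot>\<^sub>m 1\<^sub>m d"
      using pow[of n] one by (simp add: one_smult_mat)
  qed simp
  have rep: "rep g = \<rho> g" if g: "g \<in> carrier ?G" for g
  proof (cases "snd g")
    case False
    then show ?thesis using g pow[of "fst g", symmetric]
      by (cases g) (simp add: dihedral_word_def)
  next
    case True
    then have "g = (fst g, False) \<otimes>\<^bsub>?G\<^esub> dihedral_tau"
      using g by (cases g) (simp add: dihedral_tau_def)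
    moreover have "(fst g, False) \<in> carrier ?G" using g by auto
    ultimately have "\<rho> g = \<rho> (fst g, False) * \<rho> dihedral_tau"
      using mul tau by metis
    moreover have "fst g mod n = fst g" using g by auto
    ultimately show ?thesis
      using True pow[of "fst g"] by (simp add: dihedral_word_def T_def)
  qed
  \<comment> \<open>The equivalence carries \<open>\<pi>\<close> to \<open>\<rho>\<close> by
    \<open>Q\<close>, so the pair of \<open>\<rho>\<close> is transported by the adjoint of
    \<open>Q\<close>.\<close>
  let ?Q = "mat_adjoint Q"
  have Q': "unitary_mat d ?Q" using Q by (rule unitary_mat_adjoint)
  note Qc = unitary_matD(1)[OF Q]
  have "proj_eq (\<pi> g) (dihedral_word d (?Q * (M * mat_adjoint ?Q)) (?Q * (T * mat_adjoint ?Q)) g)"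
    if g: "g \<in> carrier ?G" for g
  proof -
    have "?Q * ((Q * \<pi> g * ?Q) * Q) = (?Q * Q) * (\<pi> g * (?Q * Q))"
      using Qc \<pi>[OF g] by (simp add: assoc_mult_mat[of _ d d _ d _ d] mult_carrier_mat[of _ d d _ d])
    also have "\<dots> = \<pi> g"
      using unitary_matD(2)[OF Q] \<pi>[OF g] by simp
    finally have "?Q * ((Q * \<pi> g * ?Q) * Q) = \<pi> g" .
    moreover have "proj_eq (?Q * ((Q * \<pi> g * ?Q) * Q)) (?Q * (\<rho> g * Q))"
      using Qc unitary_matD(1)[OF U[OF g g]]
      by (intro proj_eq_mult[of _ _ _ _ d] proj_eq_refl eq[OF g]) (auto intro: mult_carrier_mat)
    ultimately show ?thesis
      unfolding conj_word[OF Q'] by (simp add: rep[OF g])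
  qed
  then show ?thesis
    unfolding realizes_def using conj_unitary[OF Q'] by blast
qed

text \<open>The words themselves are the strict representation, with the identity as intertwiner. In
  contrapositive form, a genuine projective \<open>\<pi>\<close> can only be realised with
  \<open>s = -1\<close>.\<close>

lemma realized_strict_type:
  assumes n: "n \<ge> 1" and r: "realizes d n 1 M T \<pi>"
  shows "strict_type (dihedral_group n) d \<pi>"
proof -
  have pair: "dihedral_pair d n 1 M T"
    and eq: "\<And>g. g \<in> carrier (dihedral_group n) \<Longrightarrow> proj_eq (\<pi> g) (dihedral_word d M T g)"
    using r by (auto simp: realizes_def)
  interpret dihedral_pair d n 1 M T by fact
  have "1\<^sub>m d * \<pi> g * mat_adjoint (1\<^sub>m d) = \<pi> g" if "g \<in> carrier (dihedral_group n)" for g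
  proof -
    have "\<pi> g \<in> carrier_mat d d"
      using eq[OF that] by (auto simp: proj_eq_def)
    then show ?thesis by simp
  qed
  then have "equivalent_reps (dihedral_group n) d \<pi> (dihedral_word d M T)"
    unfolding equivalent_reps_def using unitary_mat_one[of d] eq by (auto simp: proj_eq_def)
  then show ?thesis
    using dihedral_pair_strict_rep[OF n pair] by (auto simp: strict_type_def)
qed

text \<open>Realisations with both signs would differ by phases, \<open>M = a M'\<close> and
  \<open>T = b T'\<close>. The two involution relations force \<open>b^2 = 1\<close> and
  \<open>(b a)^2 = 1\<close>, hence \<open>a^2 = 1\<close>, and for even \<open>n\<close> the
  \<open>n\<close>-th powers of \<open>M\<close> and \<open>M'\<close> agree, although one is
  \<open>-1\<close> and the other \<open>1\<close>.\<close>

lemma realized_not_strict_type: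
  assumes n: "n \<ge> 1" "even n" and d: "d \<ge> 1" and r: "realizes d n (-1) M T \<pi>"
  shows "\<not> strict_type (dihedral_group n) d \<pi>"
proof
  assume st: "strict_type (dihedral_group n) d \<pi>"
  interpret dihedral_pair d n "-1" M T using r by (simp add: realizes_def)
  have eq: "\<And>g. g \<in> carrier (dihedral_group n) \<Longrightarrow> proj_eq (\<pi> g) (rep g)"
    using r by (auto simp: realizes_def)
  have "\<pi> g \<in> carrier_mat d d" if "g \<in> carrier (dihedral_group n)" for g
    using eq[OF that] by (auto simp: proj_eq_def)
  from strict_type_realized[OF n(1) st this] obtain M' T'
    where r': "realizes d n 1 M' T' \<pi>" by blast
  interpret p: dihedral_pair d n 1 M' T' using r' by (simp add: realizes_def)
  have eq': "\<And>g. g \<in> carrier (dihedral_group n) \<Longrightarrow> proj_eq (\<pi> g) (p.rep g)"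
    using r' by (auto simp: realizes_def)
  have n2: "n \<ge> 2" using n by (cases "n = 1") auto
  have "proj_eq (rep g) (p.rep g)" if "g \<in> carrier (dihedral_group n)" for g
    using proj_eq_trans[OF proj_eq_sym[OF eq[OF that]] eq'[OF that]] .
  from this[of "(1, False)"] this[of "(0, True)"]
  obtain a b where a: "M = a \<cdot>\<^sub>m M'" and b: "T = b \<cdot>\<^sub>m T'"
    using n2 by (auto simp: dihedral_word_def proj_eq_def)
  have scal: "x = y" if "x \<cdot>\<^sub>m 1\<^sub>m d = y \<cdot>\<^sub>m 1\<^sub>m d" for x y :: complex
  proof -
    have "(x \<cdot>\<^sub>m 1\<^sub>m d) $$ (0, 0) = (y \<cdot>\<^sub>m 1\<^sub>m d) $$ (0, 0)" using that by simp
    then show ?thesis using d by simp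
  qed
  note sm = mult_smult_distrib[of _ d d _ d] mult_smult_assoc_mat[of _ d d _ d] smult_smult_mat
  have "(b * b) \<cdot>\<^sub>m 1\<^sub>m d = 1 \<cdot>\<^sub>m 1\<^sub>m d"
  proof -
    have "T * T = (b * b) \<cdot>\<^sub>m (T' * T')" by (simp add: b sm)
    then show ?thesis by (simp add: T_T p.T_T one_smult_mat)
  qed
  then have bb: "b * b = 1" by (rule scal)
  have "(b * a * (b * a)) \<cdot>\<^sub>m 1\<^sub>m d = 1 \<cdot>\<^sub>m 1\<^sub>m d"
  proof -
    have "T * M = (b * a) \<cdot>\<^sub>m (T' * M')" by (simp add: a b sm mult.commute)
    then have "T * M * (T * M) = (b * a * (b * a)) \<cdot>\<^sub>m (T' * M' * (T' * M'))"
      by (simp add: sm p.mult_carrier)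
    then show ?thesis by (simp add: TM_TM p.TM_TM one_smult_mat)
  qed
  then have "b * a * (b * a) = 1" by (rule scal)
  moreover have "b * a * (b * a) = (b * b) * (a * a)" by (simp only: mult_ac)
  ultimately have aa: "a * a = 1" using bb by simp
  have pow: "(a \<cdot>\<^sub>m M') ^\<^sub>m k = a ^ k \<cdot>\<^sub>m M' ^\<^sub>m k" for k
    by (induction k) (simp_all add: one_smult_mat sm mult.commute)
  have "a ^ n = (a * a) ^ (n div 2)"
    using n(2) by (metis dvd_mult_div_cancel power2_eq_square power_mult)
  then have "M ^\<^sub>m n = 1 \<cdot>\<^sub>m 1\<^sub>m d"
    unfolding a pow by (simp add: p.M_pow_n aa one_smult_mat)
  then have "(-1) \<cdot>\<^sub>m 1\<^sub>m d = (1 :: complex) \<cdot>\<^sub>m 1\<^sub>m d"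
    unfolding M_pow_n .
  from scal[OF this] show False by simp
qed

section \<open>Gram matrices of dihedral orbits\<close>

lemma index_gram:
  assumes "\<Phi> \<in> carrier_mat d N" "i < N" "j < N"
  shows "gram \<Phi> $$ (i, j) = col \<Phi> j \<bullet>c col \<Phi> i"
  using assms by (auto simp: gram_def scalar_prod_def mult.commute)

lemma index_block_gram:
  assumes "A \<in> carrier_mat n n" "B \<in> carrier_mat n n" "i < n" "j < n"
  shows "block_gram A B $$ (i, j) = A $$ (i, j)"
    and "block_gram A B $$ (i, n + j) = complex_of_real (B $$ (i, j))"
    and "block_gram A B $$ (n + i, j) = complex_of_real (B $$ (j, i))"
    and "block_gram A B $$ (n + i, n + j) = A $$ (j, i)"
  using assms by (auto simp: block_gram_def)

lemma block_gram_carrier: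
  "A \<in> carrier_mat n n \<Longrightarrow> B \<in> carrier_mat n n \<Longrightarrow> block_gram A B \<in> carrier_mat (2 * n) (2 * n)"
  by (auto simp: block_gram_def mult_2)

text \<open>\<open>perm_mat\<close> sends the \<open>j\<close>-th unit vector to the one with index
  \<open>\<sigma> j\<close>, so row \<open>i\<close> of the product is taken from the preimage of
  \<open>i\<close>; hence the inverse permutation.\<close>

lemma index_monomial_mult:
  fixes S :: "complex mat"
  assumes \<sigma>: "\<sigma> permutes {..<N}" and S: "S \<in> carrier_mat N m" and ij: "i < N" "j < m"
  shows "(mat_diag N d * perm_mat N \<sigma> * S) $$ (i, j) = d i * S $$ (inv_into UNIV \<sigma> i, j)"
proof -
  have inv: "inv_into UNIV \<sigma> i < N" "i = \<sigma> k \<longleftrightarrow> k = inv_into UNIV \<sigma> i" for k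
    using permutes_in_image[OF permutes_inv[OF \<sigma>], of i] ij permutes_inverses[OF \<sigma>] by auto
  have P: "mat_diag N d * perm_mat N \<sigma> = mat N N (\<lambda>(i, k). if i = \<sigma> k then d i else 0)"
    by (subst mat_diag_mult_left[of _ N N]) (auto simp: perm_mat_def intro!: eq_matI)
  have "(mat_diag N d * perm_mat N \<sigma> * S) $$ (i, j) =
      (\<Sum>k\<in>{0..<N}. (if i = \<sigma> k then d i else 0) * S $$ (k, j))"
    unfolding P using S ij by (simp add: scalar_prod_def)
  also have "\<dots> = (\<Sum>k\<in>{0..<N}. if k = inv_into UNIV \<sigma> i then d i * S $$ (k, j) else 0)"
    using inv(2) by (intro sum.cong) auto
  also have "\<dots> = d i * S $$ (inv_into UNIV \<sigma> i, j)"
    using inv(1) by simp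
  finally show ?thesis .
qed

lemma index_monomial_conj:
  fixes S :: "complex mat"
  assumes \<sigma>: "\<sigma> permutes {..<N}" and S: "S \<in> carrier_mat N N" and ij: "i < N" "j < N"
  shows "(mat_diag N d * perm_mat N \<sigma> * S * mat_adjoint (mat_diag N d * perm_mat N \<sigma>)) $$ (i, j) =
    d i * S $$ (inv_into UNIV \<sigma> i, inv_into UNIV \<sigma> j) * cnj (d j)"
proof -
  define P where "P = mat_diag N d * perm_mat N \<sigma>"
  note mult = index_monomial_mult[OF \<sigma>, of _ _ _ _ d, folded P_def]
  have P: "P \<in> carrier_mat N N"
    unfolding P_def by (rule mult_carrier_mat[of _ N N]) (auto simp: perm_mat_def)
  have inv: "inv_into UNIV \<sigma> i < N" if "i < N" for i
    using permutes_in_image[OF permutes_inv[OF \<sigma>], of i] that by auto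
  have PS: "P * S \<in> carrier_mat N N" using P S by (rule mult_carrier_mat)
  \<comment> \<open>Rewritten in this way, the action on columns becomes an action on rows, and the
    row formula applies a second time.\<close>
  have "P * S * mat_adjoint P = mat_adjoint (P * mat_adjoint (P * S))"
    using mat_adjoint_mult[OF P mat_adjoint_carrier[OF PS]] by simp
  also have "\<dots> $$ (i, j) = cnj ((P * mat_adjoint (P * S)) $$ (j, i))"
    using P S ij by (subst index_mat_adjoint) auto
  also have "(P * mat_adjoint (P * S)) $$ (j, i) = d j * mat_adjoint (P * S) $$ (inv_into UNIV \<sigma> j, i)"
    using mult[OF mat_adjoint_carrier[OF PS] ij(2,1)] .
  also have "mat_adjoint (P * S) $$ (inv_into UNIV \<sigma> j, i) = cnj ((P * S) $$ (i, inv_into UNIV \<sigma> j))"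
    using S P ij(1) inv[OF ij(2)] by (subst index_mat_adjoint) auto
  also have "(P * S) $$ (i, inv_into UNIV \<sigma> j) = d i * S $$ (inv_into UNIV \<sigma> i, inv_into UNIV \<sigma> j)"
    using mult[OF S ij(1) inv[OF ij(2)]] .
  finally show ?thesis by (simp add: P_def)
qed

text \<open>The transpose in \<open>permute_config\<close> gives the columns the same inverse
  permutation that \<open>index_monomial_conj\<close> gives the indices of the Gram matrix.\<close>

lemma col_permute_config:
  assumes \<sigma>: "\<sigma> permutes {..<N}" and \<Phi>: "\<Phi> \<in> carrier_mat d N" and j: "j < N"
  shows "col (permute_config N \<sigma> \<Phi>) j = col \<Phi> (inv_into UNIV \<sigma> j)"
proof (rule eq_vecI)
  have inv: "inv_into UNIV \<sigma> j < N" "j = \<sigma> k \<longleftrightarrow> k = inv_into UNIV \<sigma> j" for k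
    using permutes_in_image[OF permutes_inv[OF \<sigma>], of j] j permutes_inverses[OF \<sigma>] by auto
  fix i assume "i < dim_vec (col \<Phi> (inv_into UNIV \<sigma> j))"
  then have i: "i < d" using \<Phi> by simp
  have "col (permute_config N \<sigma> \<Phi>) j $ i =
      (\<Sum>k\<in>{0..<N}. \<Phi> $$ (i, k) * (if j = \<sigma> k then 1 else 0))"
    using \<Phi> i j by (simp add: permute_config_def perm_mat_def scalar_prod_def)
  also have "\<dots> = (\<Sum>k\<in>{0..<N}. if k = inv_into UNIV \<sigma> j then \<Phi> $$ (i, k) else 0)"
    using inv(2) by (intro sum.cong) auto
  also have "\<dots> = col \<Phi> (inv_into UNIV \<sigma> j) $ i"
    using inv(1) \<Phi> i by simp
  finally show "col (permute_config N \<sigma> \<Phi>) j $ i = col \<Phi> (inv_into UNIV \<sigma> j) $ i" .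
qed (use \<Phi> in \<open>simp add: permute_config_def\<close>)

lemma permute_config_carrier:
  "\<Phi> \<in> carrier_mat d N \<Longrightarrow> permute_config N \<sigma> \<Phi> \<in> carrier_mat d N"
  by (auto simp: permute_config_def perm_mat_def)

lemma dihedral_elem_carrier:
  "j < 2 * n \<Longrightarrow> dihedral_elem n j \<in> carrier (dihedral_group n)"
  by (auto simp: dihedral_elem_def)

lemma dihedral_orbit_carrier: "dihedral_orbit n \<pi> v \<in> carrier_mat n (2 * n)"
  by (auto simp: dihedral_orbit_def)

lemma col_dihedral_orbit:
  assumes "j < 2 * n" "\<pi> (dihedral_elem n j) \<in> carrier_mat n n" "v \<in> carrier_vec n"
  shows "col (dihedral_orbit n \<pi> v) j = \<pi> (dihedral_elem n j) *\<^sub>v v"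
  using assms by (simp add: dihedral_orbit_def)

text \<open>Up to phases the columns are the vectors \<open>M^j v\<close> and
  \<open>M^j T v\<close>, in the order of the blocks, and a diagonal switching removes the phases.
  All four blocks are then read off from the shift and reflection identities of the pair.\<close>

lemma realized_orbit_gram:
  assumes n: "n \<ge> 1" and orb: "is_dihedral_orbit n \<pi> \<Phi>" and r: "realizes n n s M T \<pi>"
  shows "\<exists>A B. dihedral_blocks n A B \<and> switching_equiv (2 * n) (gram \<Phi>) (block_gram A B) \<and>
    (s = 1 \<longrightarrow> circulant n A \<and> circulant n B) \<and> (s = -1 \<longrightarrow> negacirculant n A \<and> negacirculant n B)"
proof -
  interpret dihedral_pair n n s M T using r by (simp add: realizes_def)
  obtain v where v: "v \<in> carrier_vec n" and \<Phi>: "\<Phi> = dihedral_orbit n \<pi> v"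
    using orb unfolding is_dihedral_orbit_def by blast
  define x where "x e j = M ^\<^sub>m j *\<^sub>v ((if e then T else 1\<^sub>m n) *\<^sub>v v)" for e j
  define A where "A = mat n n (\<lambda>(i, j). x False j \<bullet>c x False i)"
  define B where "B = mat n n (\<lambda>(i, j). Re (x True j \<bullet>c x False i))"
  have xc: "x e j \<in> carrier_vec n" for e j using v by (simp add: x_def)
  have shift: "x e j \<bullet>c x False i = (if i \<le> j then x e (j - i) \<bullet>c v else s * (x e (n + j - i) \<bullet>c v))"
    if "i < n" for e i j
    using cscalar_prod_pow[of "(if e then T else 1\<^sub>m n) *\<^sub>v v" v i j] v that
    by (simp add: x_def)
  have B_real: "complex_of_real (Re (x True j \<bullet>c x False i)) = x True j \<bullet>c x False i" if "i < n" for i j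
    using cscalar_prod_reflection_real[OF v, of i j] that v by (simp add: x_def)
  have flip: "x True j \<bullet>c x True i = x False i \<bullet>c x False j" for i j
    using cscalar_prod_reflection_reflection[OF v, of j i] v by (simp add: x_def)
  have AB: "A \<in> carrier_mat n n" "B \<in> carrier_mat n n" by (auto simp: A_def B_def)
  have A_entry: "A $$ (i, j) = x False j \<bullet>c x False i" if "i < n" "j < n" for i j
    using that by (simp add: A_def)
  have B_entry: "complex_of_real (B $$ (i, j)) = x True j \<bullet>c x False i" if "i < n" "j < n" for i j
    using that B_real by (simp add: B_def)
  have "mat_adjoint A = A"
    by (rule eq_matI) (auto simp: A_def simp flip: cscalar_prod_commute[OF xc xc])
  then have blocks: "dihedral_blocks n A B" using AB by (simp add: dihedral_blocks_def)

  let ?y = "\<lambda>j. if j < n then x False j else x True (j - n)"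
  have "\<exists>c. cmod c = 1 \<and> col \<Phi> j = c \<cdot>\<^sub>v ?y j" if j: "j < 2 * n" for j
  proof -
    let ?g = "dihedral_elem n j"
    obtain c where c: "cmod c = 1" "\<pi> ?g = c \<cdot>\<^sub>m rep ?g"
      using r dihedral_elem_carrier[OF j] unfolding realizes_def proj_eq_def by blast
    have "col \<Phi> j = c \<cdot>\<^sub>v (rep ?g *\<^sub>v v)"
      unfolding \<Phi> using j v by (simp add: col_dihedral_orbit c smult_mat_mult_vec[of _ n n])
    also have "rep ?g *\<^sub>v v = ?y j"
      using v by (simp add: dihedral_elem_def dihedral_word_def x_def assoc_mult_mat_vec[of _ n n _ n])
    finally show ?thesis using c(1) by blast
  qed
  then obtain c where c: "\<And>j. j < 2 * n \<Longrightarrow> cmod (c j) = 1 \<and> col \<Phi> j = c j \<cdot>\<^sub>v ?y j"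
    by metis
  have \<Phi>c: "\<Phi> \<in> carrier_mat n (2 * n)" unfolding \<Phi> by (rule dihedral_orbit_carrier)
  then have Gc: "gram \<Phi> \<in> carrier_mat (2 * n) (2 * n)" by (auto simp: gram_def)
  \<comment> \<open>The diagonal is \<open>c\<close> and not its conjugate, because the Gram entry
    \<open>(i, j)\<close> carries the factor \<open>cnj (c i) * c j\<close>.\<close>
  let ?D = "mat_diag (2 * n) c * perm_mat (2 * n) id"
  have id: "id permutes {..<2 * n}" by (rule permutes_id)
  have Dc: "?D \<in> carrier_mat (2 * n) (2 * n)"
    by (rule mult_carrier_mat[of _ "2 * n" "2 * n"]) (auto simp: perm_mat_def)
  have "block_gram A B = ?D * gram \<Phi> * mat_adjoint ?D"
  proof (rule eq_matI)
    show "dim_row (block_gram A B) = dim_row (?D * gram \<Phi> * mat_adjoint ?D)"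
      "dim_col (block_gram A B) = dim_col (?D * gram \<Phi> * mat_adjoint ?D)"
      using block_gram_carrier[OF AB] Dc Gc by auto
    fix i j assume "i < dim_row (?D * gram \<Phi> * mat_adjoint ?D)" "j < dim_col (?D * gram \<Phi> * mat_adjoint ?D)"
    then have ij: "i < 2 * n" "j < 2 * n" using Dc by auto
    have cc: "c i * cnj (c i) = 1" if "i < 2 * n" for i
      using c[OF that] complex_norm_square[of "c i"] by simp
    have yc: "?y j \<in> carrier_vec n" for j using xc by simp
    have "(?D * gram \<Phi> * mat_adjoint ?D) $$ (i, j) = c i * (col \<Phi> j \<bullet>c col \<Phi> i) * cnj (c j)"
      using index_monomial_conj[OF id Gc ij] by (simp add: index_gram[OF \<Phi>c ij])
    also have "col \<Phi> j \<bullet>c col \<Phi> i = cnj (c i) * (c j * (?y j \<bullet>c ?y i))"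
      using c[OF ij(1)] c[OF ij(2)] yc[of i] yc[of j]
      by (simp only: cscalar_prod_smult[of _ n] smult_carrier_vec)
    also have "c i * (cnj (c i) * (c j * (?y j \<bullet>c ?y i))) * cnj (c j) =
        (c i * cnj (c i)) * (c j * cnj (c j)) * (?y j \<bullet>c ?y i)"
      by (simp only: mult_ac)
    also have "\<dots> = ?y j \<bullet>c ?y i"
      by (simp only: cc ij mult_1_left)
    finally have entry: "(?D * gram \<Phi> * mat_adjoint ?D) $$ (i, j) = ?y j \<bullet>c ?y i" .
    have halves: "k < n \<or> (\<exists>k'<n. k = n + k')" if "k < 2 * n" for k
      using that by (cases "k < n") (auto intro!: exI[of _ "k - n"])
    consider "i < n" "j < n" | j' where "i < n" "j = n + j'" "j' < n"
      | i' where "i = n + i'" "i' < n" "j < n" | i' j' where "i = n + i'" "i' < n" "j = n + j'" "j' < n"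
      using halves[OF ij(1)] halves[OF ij(2)] by blast
    then have "block_gram A B $$ (i, j) = ?y j \<bullet>c ?y i"
    proof cases
      case 1
      then show ?thesis by (simp add: index_block_gram[OF AB] A_entry)
    next
      case 2
      then show ?thesis by (simp add: index_block_gram[OF AB] B_entry)
    next
      case 3
      have "x False j \<bullet>c x True i' = cnj (x True i' \<bullet>c x False j)"
        by (rule cscalar_prod_commute[OF xc xc])
      also have "\<dots> = complex_of_real (B $$ (j, i'))"
        unfolding B_entry[OF 3(3,2), symmetric] by (rule complex_cnj_complex_of_real)
      finally show ?thesis
        using 3 by (simp add: index_block_gram[OF AB])
    next
      case 4
      then show ?thesis by (simp add: index_block_gram[OF AB] A_entry flip)
    qed
    then show "block_gram A B $$ (i, j) = (?D * gram \<Phi> * mat_adjoint ?D) $$ (i, j)"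
      using entry by simp
  qed
  moreover have "phase_monomial (2 * n) ?D"
    using c id unfolding phase_monomial_def by blast
  ultimately have "switching_equiv (2 * n) (gram \<Phi>) (block_gram A B)"
    unfolding switching_equiv_def by blast
  moreover have "circulant n A \<and> circulant n B" if s: "s = 1"
  proof -
    have "x e j \<bullet>c x False i = x e (nat ((int j - int i) mod int n)) \<bullet>c v" if "i < n" "j < n" for e i j
    proof (cases "i \<le> j")
      case True
      then have "(int j - int i) mod int n = int (j - i)" using that by (simp add: of_nat_diff)
      then show ?thesis using shift[OF that(1), of e j] True by (simp del: of_nat_diff)
    next
      case False
      \<comment> \<open>A negative difference is reduced by adding one period, which is the exponent
        of the second case of \<open>shift\<close>; for \<open>s = 1\<close> that case has no
        sign.\<close>
      then have "(int j - int i) mod int n = (int j - int i + int n) mod int n" by simp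
      also have "\<dots> = int (n + j - i)" using False that by (subst mod_pos_pos_trivial) auto
      finally show ?thesis using shift[OF that(1), of e j] False s by (simp del: of_nat_diff)
    qed
    then show ?thesis
      unfolding circulant_def A_def B_def
      by (auto intro!: exI[of _ "\<lambda>k. x False (nat k) \<bullet>c v"] exI[of _ "\<lambda>k. Re (x True (nat k) \<bullet>c v)"])
  qed
  moreover have "negacirculant n A \<and> negacirculant n B" if s: "s = -1"
  proof
    show "negacirculant n A"
      unfolding negacirculant_def
      by (intro bexI[of _ "vec n (\<lambda>k. x False k \<bullet>c v)"]) (auto simp: A_def shift s)
    show "negacirculant n B"
      unfolding negacirculant_def
      by (intro bexI[of _ "vec n (\<lambda>k. Re (x True k \<bullet>c v))"]) (auto simp: B_def shift s)
  qed
  ultimately show ?thesis using blocks by blast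
qed

section \<open>Recovering a dihedral pair and its orbit from a circulant or negacirculant Gram
  matrix\<close>

lemma quasi_periodic:
  fixes f :: "int \<Rightarrow> complex"
  assumes per: "\<And>k. f (k + n) = s * f k" and s: "s * s = 1"
  shows "f (k + n * t) = (if even t then 1 else s) * f k"
proof (induction t rule: int_induct[of _ 0])
  case base
  then show ?case by simp
next
  case (step1 t)
  have "f (k + n * (t + 1)) = s * f (k + n * t)"
    using per[of "k + n * t"] by (simp add: algebra_simps)
  then show ?case using step1 s by (simp flip: mult.assoc)
next
  case (step2 t)
  have "f (k + n * t) = s * f (k + n * (t - 1))"
    using per[of "k + n * (t - 1)"] by (simp add: algebra_simps)
  \<comment> \<open>As \<open>s\<close> is its own inverse, the quasi-period can also be used
    downwards.\<close>
  then have "s * f (k + n * t) = f (k + n * (t - 1))" using s by (simp flip: mult.assoc)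
  then show ?case using step2 s by (auto simp flip: mult.assoc)
qed

lemma conjugate_append_vec:
  "conjugate (x @\<^sub>v y) = conjugate x @\<^sub>v conjugate (y :: complex vec)"
  by (rule eq_vecI) auto

text \<open>The quasi-periodic extension of the vectors to all integer indices makes both generators act
  by index arithmetic. On the orthogonal complement of the span the generators are chosen freely,
  subject to the parity constraint of \<open>even_dimension\<close>.\<close>

lemma dihedral_pair_of_gram:
  fixes p :: "nat \<Rightarrow> complex vec" and a b :: "int \<Rightarrow> complex"
  assumes sign: "s = 1 \<or> s = -1" and n: "n \<ge> 1"
    and p: "\<And>j. j < 2 * n \<Longrightarrow> p j \<in> carrier_vec n"
    and per: "\<And>k. a (k + int n) = s * a k" "\<And>k. b (k + int n) = s * b k"
    and g: "\<And>i j. i < n \<Longrightarrow> j < n \<Longrightarrow> p j \<bullet>c p i = a (int j - int i)"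
      "\<And>i j. i < n \<Longrightarrow> j < n \<Longrightarrow> p (n + j) \<bullet>c p i = b (int j - int i)"
      "\<And>i j. i < n \<Longrightarrow> j < n \<Longrightarrow> p j \<bullet>c p (n + i) = b (int i - int j)"
      "\<And>i j. i < n \<Longrightarrow> j < n \<Longrightarrow> p (n + j) \<bullet>c p (n + i) = a (int i - int j)"
  shows "\<exists>M T. dihedral_pair n n s M T \<and>
    (\<forall>j<2 * n. p j = dihedral_word n M T (dihedral_elem n j) *\<^sub>v p 0)"
proof -
  \<comment> \<open>In the coordinates of \<open>U\<close> the vectors fill the first
    \<open>r\<close> coordinates and vanish on the last \<open>m\<close>, so the two parts can be
    treated separately.\<close>
  obtain r m U q where rm: "n = r + m" and U: "unitary_mat n U" and q: "full_family r (2 * n) q"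
    and pq: "\<And>j. j < 2 * n \<Longrightarrow> p j = U *\<^sub>v (q j @\<^sub>v 0\<^sub>v m)"
    using exists_full_family[of "2 * n" p n] p by blast
  have qc: "q j \<in> carrier_vec r" if "j < 2 * n" for j
    using q that by (auto simp: full_family_def)
  have qn: "q j @\<^sub>v 0\<^sub>v m \<in> carrier_vec n" if "j < 2 * n" for j
    using qc[OF that] rm by auto
  have gram_q: "q j \<bullet>c q i = p j \<bullet>c p i" if "i < 2 * n" "j < 2 * n" for i j
  proof -
    have "p j \<bullet>c p i = (q j @\<^sub>v 0\<^sub>v m) \<bullet>c (q i @\<^sub>v 0\<^sub>v m)"
      unfolding pq[OF that(1)] pq[OF that(2)] using qn that by (intro unitary_mat_cscalar_prod[OF U])
    also have "\<dots> = q j \<bullet>c q i"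
      unfolding conjugate_append_vec using qc[OF that(1)] qc[OF that(2)]
      by (subst scalar_prod_append[of _ r _ m]) auto
    finally show ?thesis by simp
  qed
  \<comment> \<open>The integer power of \<open>s\<close>, which depends only on the parity of the
    exponent.\<close>
  define sg where "sg t = (if even t then 1 else s)" for t :: int
  have ss: "s * s = 1" "cnj s = s" using sign by auto
  have sg: "sg (t + t') = sg t * sg t'" "sg (t - t') = sg t * sg t'" "sg (- t) = sg t"
    "cnj (sg t) = sg t" for t t'
    using ss by (auto simp: sg_def)
  have apply_per: "a (k + int n * t) = sg t * a k" "b (k + int n * t) = sg t * b k" for k t
    using quasi_periodic[of a "int n" s k t] quasi_periodic[of b "int n" s k t] per ss
    by (auto simp: sg_def)
  define ix where "ix e k = (if e then n else 0) + nat (k mod int n)" for e :: bool and k :: int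
  have nat_mod: "nat (k mod int n) < n" for k
    using n by (simp add: nat_less_iff)
  have ix: "ix e k < 2 * n" for e k
    using nat_mod[of k] by (simp add: ix_def)
  \<comment> \<open>\<open>u e k\<close> is the intended value of \<open>M^k T^e\<close> at the base
    vector for every integer \<open>k\<close>; the factor \<open>sg (k div int n)\<close> accounts
    for the full periods, since \<open>M^n\<close> has to be \<open>s\<close>.\<close>
  define u where "u e k = sg (k div int n) \<cdot>\<^sub>v q (ix e k)" for e k
  have uc: "u e k \<in> carrier_vec r" for e k using qc[OF ix] by (simp add: u_def)
  have u_shift: "u e (k + int n * t) = sg t \<cdot>\<^sub>v u e k" for e k t
    using n by (simp add: u_def ix_def sg smult_smult_assoc mult.commute)
  have u_int: "u e (int k) = q ((if e then n else 0) + k)" if "k < n" for e k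
    using that by (simp add: u_def ix_def sg_def)
  have u_base: "q j = u (n \<le> j) (int (if n \<le> j then j - n else j))" if "j < 2 * n" for j
    using u_int[of j False] u_int[of "j - n" True] that by (cases "n \<le> j") (simp_all del: of_nat_diff)
  have u_red: "u e k = sg (k div int n) \<cdot>\<^sub>v u e (k mod int n)" for e k
    using u_shift[of e "k mod int n" "k div int n"] by simp
  \<comment> \<open>The value depends only on whether \<open>e = f\<close> and on a difference of
    indices whose orientation is fixed by \<open>e\<close>. Hence raising all indices by one
    preserves it, and so does negating them while switching both halves.\<close>
  have inner: "u f j \<bullet>c u e i = (if e = f then a else b) (if e then i - j else j - i)" for e f i j
  proof -
    let ?i = "nat (i mod int n)" and ?j = "nat (j mod int n)"
    let ?h = "if e = f then a else b"
    have i: "i = int ?i + int n * (i div int n)" and j: "j = int ?j + int n * (j div int n)"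
      using n by simp_all
    have h: "?h (k + int n * t) = sg t * ?h k" for k t using apply_per by simp
    have "u f j \<bullet>c u e i = sg (j div int n) * (sg (i div int n) * (q (ix f j) \<bullet>c q (ix e i)))"
      using qc[OF ix] by (simp add: u_def cscalar_prod_smult[of _ r] sg)
    also have "q (ix f j) \<bullet>c q (ix e i) = ?h (if e then int ?i - int ?j else int ?j - int ?i)"
      unfolding gram_q[OF ix ix] unfolding ix_def
      using g[OF nat_mod[of i] nat_mod[of j]] by (cases e; cases f) simp_all
    also have "sg (j div int n) * (sg (i div int n) * \<dots>) =
        ?h ((if e then int ?i - int ?j else int ?j - int ?i) +
          int n * (if e then i div int n - j div int n else j div int n - i div int n))"
      unfolding h by (simp add: sg mult_ac)
    also have "(if e then int ?i - int ?j else int ?j - int ?i) +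
          int n * (if e then i div int n - j div int n else j div int n - i div int n) =
        (if e then i - j else j - i)"
      using i j by (simp add: algebra_simps)
    finally show ?thesis .
  qed
  have u_eqI: "X = Y" if "X \<in> carrier_mat r r" "Y \<in> carrier_mat r r"
    "\<And>e k. X *\<^sub>v u e k = Y *\<^sub>v u e k" for X Y
    using full_family_eqI[OF q that(1,2)] that(3) u_base by metis
  \<comment> \<open>Any relabelling of the extended family that respects the quasi-period and the
    inner products comes from a unitary of the span.\<close>
  have extend: "\<exists>V. unitary_mat r V \<and> (\<forall>e k. V *\<^sub>v u e k = w e k)"
    if wc: "\<And>e k. w e k \<in> carrier_vec r" and w_shift: "\<And>e k t. w e (k + int n * t) = sg t \<cdot>\<^sub>v w e k"
      and w: "\<And>e f i j. w f j \<bullet>c w e i = u f j \<bullet>c u e i" for w :: "bool \<Rightarrow> int \<Rightarrow> complex vec"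
  proof -
    let ?k = "\<lambda>j. int (if n \<le> j then j - n else j)"
    obtain V where V: "unitary_mat r V" "\<And>j. j < 2 * n \<Longrightarrow> V *\<^sub>v q j = w (n \<le> j) (?k j)"
    proof (rule exists_unitary_mapping[OF q, of "\<lambda>j. w (n \<le> j) (?k j)"])
      fix i j assume "i < 2 * n" "j < 2 * n"
      then show "w (n \<le> i) (?k i) \<bullet>c w (n \<le> j) (?k j) = q i \<bullet>c q j"
        unfolding w by (simp only: flip: u_base)
    qed (use wc in auto)
    have "V *\<^sub>v u e k = w e k" for e k
    proof -
      have "V *\<^sub>v u e k = sg (k div int n) \<cdot>\<^sub>v (V *\<^sub>v q (ix e k))"
        unfolding u_def using unitary_matD(1)[OF V(1)] qc[OF ix] by (rule mult_mat_vec)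
      also have "V *\<^sub>v q (ix e k) = w e (k mod int n)"
        using V(2)[OF ix, of e k] nat_mod[of k] n by (auto simp: ix_def)
      also have "sg (k div int n) \<cdot>\<^sub>v \<dots> = w e k"
        using w_shift[of e "k mod int n" "k div int n"] by simp
      finally show ?thesis .
    qed
    then show ?thesis using V(1) by blast
  qed
  obtain M1 where M1: "unitary_mat r M1" and M1u: "\<And>e k. M1 *\<^sub>v u e k = u e (k + 1)"
    using extend[of "\<lambda>e k. u e (k + 1)"] uc u_shift[of _ "_ + 1"]
    by (force simp: inner algebra_simps)
  \<comment> \<open>The rule anticipates \<open>T M^k T^e = M^(-k) T^(e+1)\<close>.\<close>
  obtain T1 where T1: "unitary_mat r T1" and T1u: "\<And>e k. T1 *\<^sub>v u e k = u (\<not> e) (- k)"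
  proof -
    have "u (\<not> e) (- (k + int n * t)) = sg t \<cdot>\<^sub>v u (\<not> e) (- k)" for e k t
      using u_shift[of "\<not> e" "- k" "- t"] by (simp add: sg)
    then show ?thesis
      using that extend[of "\<lambda>e k. u (\<not> e) (- k)"] uc by (force simp: inner)
  qed
  note M1c = unitary_matD(1)[OF M1] and T1c = unitary_matD(1)[OF T1]
  have M1_pow: "M1 ^\<^sub>m t *\<^sub>v u e k = u e (k + int t)" for t e k
  proof (induction t arbitrary: k)
    case 0
    then show ?case using M1c uc by simp
  next
    case (Suc t)
    then show ?case
      using M1c uc M1u by (simp add: assoc_mult_mat_vec[of _ r r _ r] algebra_simps)
  qed
  have pair1: "dihedral_pair r n s M1 T1"
  proof
    show "unitary_mat r M1" "unitary_mat r T1" by fact+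
    show "T1 * T1 = 1\<^sub>m r"
      by (rule u_eqI) (use T1c uc T1u in \<open>auto simp: assoc_mult_mat_vec[of _ r r _ r]\<close>)
    show "T1 * M1 * (T1 * M1) = 1\<^sub>m r"
      by (rule u_eqI) (use M1c T1c uc T1u M1u mult_carrier_mat[OF T1c M1c] in
          \<open>auto simp: assoc_mult_mat_vec[of _ r r _ r]\<close>)
    show "M1 ^\<^sub>m n = s \<cdot>\<^sub>m 1\<^sub>m r"
    proof (rule u_eqI)
      fix e k
      have "u e (k + int n) = s \<cdot>\<^sub>v u e k"
        using u_shift[of e k 1] by (simp add: sg_def)
      then show "M1 ^\<^sub>m n *\<^sub>v u e k = s \<cdot>\<^sub>m 1\<^sub>m r *\<^sub>v u e k"
        using uc by (simp add: M1_pow smult_one_mat_mult_vec)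
    qed (use M1c in auto)
  qed (rule sign)
  \<comment> \<open>The pair on the span forces \<open>r\<close> to be even, and
    \<open>n = r + m\<close> is even.\<close>
  have "even m" if "s = -1" "even n"
    using dihedral_pair.even_dimension[OF pair1 that] that(2) rm by simp
  then obtain M2 T2 where pair2: "dihedral_pair m n s M2 T2"
    using dihedral_pair_exists[OF sign _ n, of m] by blast
  interpret p1: dihedral_pair r n s M1 T1 by fact
  interpret p2: dihedral_pair m n s M2 T2 by fact
  let ?M = "direct_sum M1 M2" and ?T = "direct_sum T1 T2"
  interpret pr: dihedral_pair n n s ?M ?T
    using dihedral_pair_direct_sum[OF pair1 pair2] by (simp flip: rm)
  have word: "p1.rep (dihedral_elem n j) *\<^sub>v q 0 = q j" if j: "j < 2 * n" for j
  proof -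
    have q0: "q 0 = u False 0" using u_base[of 0] n by simp
    have "p1.rep (dihedral_elem n j) *\<^sub>v u False 0 = u (n \<le> j) (int (if n \<le> j then j - n else j))"
    proof (cases "n \<le> j")
      case True
      then show ?thesis
        using uc T1u M1_pow by (simp add: dihedral_elem_def dihedral_word_def assoc_mult_mat_vec[of _ r r _ r])
    next
      case False
      then show ?thesis
        using uc M1_pow by (simp add: dihedral_elem_def dihedral_word_def)
    qed
    then show ?thesis using u_base[OF j] q0 by simp
  qed
  have "p j = dihedral_word n (U * (?M * mat_adjoint U)) (U * (?T * mat_adjoint U)) (dihedral_elem n j) *\<^sub>v p 0"
    if j: "j < 2 * n" for j
  proof -
    let ?g = "dihedral_elem n j"
    note Uc = unitary_matD(1)[OF U]
    have 0: "0 < 2 * n" using n by simp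
    have p0: "p 0 \<in> carrier_vec n" using p[OF 0] .
    \<comment> \<open>The orbit has no component in the complement, so the choice of
      \<open>M2\<close> and \<open>T2\<close> does not affect it.\<close>
    have zero: "p2.rep ?g *\<^sub>v 0\<^sub>v m = 0\<^sub>v m"
      by (rule eq_vecI) (auto simp: carrier_matD[OF p2.rep_carrier] scalar_prod_def)
    have "mat_adjoint U *\<^sub>v p 0 = q 0 @\<^sub>v 0\<^sub>v m"
      unfolding pq[OF 0] using unitary_mat_mult_adjoint_vec(1)[OF U qn[OF 0]] .
    then have "(U * (pr.rep ?g * mat_adjoint U)) *\<^sub>v p 0 = U *\<^sub>v (pr.rep ?g *\<^sub>v (q 0 @\<^sub>v 0\<^sub>v m))"
      using Uc p0 by (simp add: assoc_mult_mat_vec[of _ n n _ n] mult_carrier_mat[of _ n n _ n])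
    also have ds: "pr.rep ?g = direct_sum (p1.rep ?g) (p2.rep ?g)"
      using dihedral_word_direct_sum[OF p1.M_carrier p1.T_carrier p2.M_carrier p2.T_carrier]
      by (simp add: rm)
    also have "\<dots> *\<^sub>v (q 0 @\<^sub>v 0\<^sub>v m) = q j @\<^sub>v 0\<^sub>v m"
      using direct_sum_mult_vec[OF p1.rep_carrier p2.rep_carrier qc[OF 0] zero_carrier_vec[of m], of ?g ?g]
        word[OF j] zero by simp
    finally show ?thesis
      unfolding pr.conj_word[OF U] pq[OF j] ds by simp
  qed
  then show ?thesis using pr.conj_unitary[OF U] by blast
qed

lemma circulant_quasi_periodic:
  assumes "circulant n C"
  obtains c where "\<And>k. c (k + int n) = c k" "\<And>i j. i < n \<Longrightarrow> j < n \<Longrightarrow> C $$ (i, j) = c (int j - int i)"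
proof -
  obtain c where "\<forall>i<n. \<forall>j<n. C $$ (i, j) = c ((int j - int i) mod int n)"
    using assms by (auto simp: circulant_def)
  then show ?thesis using that[of "\<lambda>k. c (k mod int n)"] by simp
qed

text \<open>The defining vector is extended to all integers with a sign change after each period;
  the matrix uses only the indices strictly between \<open>-n\<close> and \<open>n\<close>.\<close>

lemma negacirculant_quasi_periodic:
  assumes "negacirculant n C" and n: "n \<ge> 1"
  obtains c where "\<And>k. c (k + int n) = - c k" "\<And>i j. i < n \<Longrightarrow> j < n \<Longrightarrow> C $$ (i, j) = c (int j - int i)"
proof -
  obtain v where v: "\<And>i j. i < n \<Longrightarrow> j < n \<Longrightarrow>
      C $$ (i, j) = (if i \<le> j then v $ (j - i) else - (v $ (n + j - i)))"
    using assms by (auto simp: negacirculant_def)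
  define c where "c k = (if even (k div int n) then v $ nat (k mod int n) else - (v $ nat (k mod int n)))" for k
  have "c (k + int n) = - c k" for k
    using n by (simp add: c_def)
  moreover have "C $$ (i, j) = c (int j - int i)" if ij: "i < n" "j < n" for i j
  proof (cases "i \<le> j")
    case True
    then have "int j - int i = int (j - i)" by simp
    moreover have "c (int (j - i)) = v $ (j - i)"
      using ij by (simp add: c_def del: of_nat_diff)
    ultimately show ?thesis using v[OF ij] True by simp
  next
    case False
    \<comment> \<open>Below the diagonal the quotient is \<open>-1\<close>, which is odd and
      produces the sign, and the remainder is the index \<open>n + j - i\<close>.\<close>
    have dm: "(int j - int i) div int n = -1" "(int j - int i) mod int n = int j - int i + int n"
      using False ij int_div_pos_eq[of "int j - int i" "int n" "-1" "int j - int i + int n"]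
        int_mod_pos_eq[of "int j - int i" "int n" "-1" "int j - int i + int n"] by auto
    have "c (int j - int i) = - (v $ nat (int j - int i + int n))"
      unfolding c_def dm by simp
    also have "nat (int j - int i + int n) = n + j - i" using False ij by auto
    finally show ?thesis using v[OF ij] False by simp
  qed
  ultimately show ?thesis using that by blast
qed

text \<open>Permuting and rephasing the columns gives vectors \<open>p j\<close> whose Gram matrix
  is exactly the block matrix, so they form an orbit under words. The phases are then moved into
  \<open>\<pi>\<close>, while the permutation stays visible in the configuration.\<close>

lemma dihedral_orbit_of_gram:
  fixes a :: "int \<Rightarrow> complex" and b :: "int \<Rightarrow> real"
  assumes n: "n \<ge> 1" and sign: "s = 1 \<or> s = -1"
    and \<Phi>: "unit_config n (2 * n) \<Phi>" and blocks: "dihedral_blocks n A B"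
    and sw: "switching_equiv_via (2 * n) \<sigma> (gram \<Phi>) (block_gram A B)"
    and per: "\<And>k. a (k + int n) = s * a k" "\<And>k. complex_of_real (b (k + int n)) = s * complex_of_real (b k)"
    and A: "\<And>i j. i < n \<Longrightarrow> j < n \<Longrightarrow> A $$ (i, j) = a (int j - int i)"
    and B: "\<And>i j. i < n \<Longrightarrow> j < n \<Longrightarrow> B $$ (i, j) = b (int j - int i)"
  shows "\<exists>\<pi> M T. is_dihedral_orbit n \<pi> (permute_config (2 * n) \<sigma> \<Phi>) \<and> realizes n n s M T \<pi>"
proof -
  have \<Phi>c: "\<Phi> \<in> carrier_mat n (2 * n)" and unit: "\<And>j. j < 2 * n \<Longrightarrow> col \<Phi> j \<bullet>c col \<Phi> j = 1"
    using \<Phi> by (auto simp: unit_config_def)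
  have AB: "A \<in> carrier_mat n n" "B \<in> carrier_mat n n"
    using blocks by (auto simp: dihedral_blocks_def)
  obtain d where \<sigma>: "\<sigma> permutes {..<2 * n}" and d: "\<And>i. i < 2 * n \<Longrightarrow> cmod (d i) = 1"
    and eq: "block_gram A B = mat_diag (2 * n) d * perm_mat (2 * n) \<sigma> * gram \<Phi> *
      mat_adjoint (mat_diag (2 * n) d * perm_mat (2 * n) \<sigma>)"
    using sw unfolding switching_equiv_via_def by blast
  have Gc: "gram \<Phi> \<in> carrier_mat (2 * n) (2 * n)" using \<Phi>c by (auto simp: gram_def)
  let ?\<sigma> = "inv_into UNIV \<sigma>"
  have inv: "?\<sigma> j < 2 * n" if "j < 2 * n" for j
    using permutes_in_image[OF permutes_inv[OF \<sigma>], of j] that by auto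
  \<comment> \<open>The conjugate is needed because the second argument of the inner product is
    conjugated: the factor for \<open>(i, j)\<close> becomes \<open>d i * cnj (d j)\<close>, as in
    the switching.\<close>
  define p where "p j = cnj (d j) \<cdot>\<^sub>v col \<Phi> (?\<sigma> j)" for j
  have cc: "col \<Phi> j \<in> carrier_vec n" for j using \<Phi>c by auto
  have p: "p j \<in> carrier_vec n" for j using cc by (simp add: p_def)
  have gram_p: "p j \<bullet>c p i = block_gram A B $$ (i, j)" if "i < 2 * n" "j < 2 * n" for i j
  proof -
    have "block_gram A B $$ (i, j) = d i * (col \<Phi> (?\<sigma> j) \<bullet>c col \<Phi> (?\<sigma> i)) * cnj (d j)"
      unfolding eq index_monomial_conj[OF \<sigma> Gc that] index_gram[OF \<Phi>c inv[OF that(1)] inv[OF that(2)]] ..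
    then show ?thesis
      using cc by (simp add: p_def cscalar_prod_smult[of _ n])
  qed
  have "\<exists>M T. dihedral_pair n n s M T \<and>
    (\<forall>j<2 * n. p j = dihedral_word n M T (dihedral_elem n j) *\<^sub>v p 0)"
    by (rule dihedral_pair_of_gram[where a = a and b = "\<lambda>k. complex_of_real (b k)", OF sign n p per])
      (simp_all add: gram_p index_block_gram[OF AB] A B)
  then obtain M T where pair: "dihedral_pair n n s M T"
    and word: "\<And>j. j < 2 * n \<Longrightarrow> p j = dihedral_word n M T (dihedral_elem n j) *\<^sub>v p 0"
    by blast
  interpret dihedral_pair n n s M T by fact
  \<comment> \<open>The argument of \<open>d\<close> is the position of \<open>g\<close> in the
    enumeration \<open>dihedral_elem\<close>; the factor undoes the phase put into
    \<open>p\<close>.\<close>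
  define \<pi> where "\<pi> g = d (if snd g then n + fst g else fst g) \<cdot>\<^sub>m rep g" for g
  have \<pi>: "proj_eq (\<pi> g) (rep g)" if "g \<in> carrier (dihedral_group n)" for g
    unfolding \<pi>_def using that by (intro proj_eq_smult d) auto
  have "projective_rep (dihedral_group n) n \<pi>"
    using dihedral_pair_projective_rep[OF pair \<pi> n] .
  moreover have "p 0 \<bullet>c p 0 = 1"
  proof -
    have "cnj (d 0) * d 0 = 1"
      using d[of 0] n complex_norm_square[of "d 0"] by (simp add: mult.commute)
    then show ?thesis
      using unit[OF inv[of 0]] n cc by (simp add: p_def cscalar_prod_smult[of _ n] mult.commute)
  qed
  moreover have "permute_config (2 * n) \<sigma> \<Phi> = dihedral_orbit n \<pi> (p 0)"
  proof (rule mat_col_eqI)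
    fix j assume "j < dim_col (dihedral_orbit n \<pi> (p 0))"
    then have j: "j < 2 * n" using dihedral_orbit_carrier[of n \<pi> "p 0"] by auto
    have dj: "d j * cnj (d j) = 1"
      using d[OF j] complex_norm_square[of "d j"] by simp
    have \<pi>j: "\<pi> (dihedral_elem n j) = d j \<cdot>\<^sub>m rep (dihedral_elem n j)"
      by (simp add: \<pi>_def dihedral_elem_def)
    have "col (dihedral_orbit n \<pi> (p 0)) j = d j \<cdot>\<^sub>v (rep (dihedral_elem n j) *\<^sub>v p 0)"
      using j p by (simp add: col_dihedral_orbit \<pi>j smult_mat_mult_vec[of _ n n])
    also have "\<dots> = d j \<cdot>\<^sub>v p j"
      using word[OF j] by simp
    also have "\<dots> = col \<Phi> (?\<sigma> j)"
      by (simp add: p_def smult_smult_assoc dj)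
    finally show "col (permute_config (2 * n) \<sigma> \<Phi>) j = col (dihedral_orbit n \<pi> (p 0)) j"
      using col_permute_config[OF \<sigma> \<Phi>c j] by simp
  qed (use permute_config_carrier[OF \<Phi>c, of \<sigma>] dihedral_orbit_carrier[of n \<pi> "p 0"] in auto)
  ultimately show ?thesis
    using pair \<pi> p unfolding is_dihedral_orbit_def realizes_def by blast
qed

text \<open>In the negacirculant converse, genuineness is restricted to even \<open>n\<close>: for
  odd \<open>n\<close>, replacing \<open>M\<close> by \<open>-M\<close> turns a pair with
  \<open>s = -1\<close> into one with \<open>s = 1\<close>, so the orbit has strict type.\<close>

theorem theorem4p3:
  fixes n :: nat and \<Phi> :: "complex mat"
  assumes "n \<ge> 1"
  shows
    "(dihedral_config n \<Phi> \<longrightarrow>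
        (\<exists>A B. dihedral_blocks n A B \<and> switching_equiv (2 * n) (gram \<Phi>) (block_gram A B))) \<and>
     (strict_dihedral_config n \<Phi> \<longrightarrow>
        (\<exists>A B. dihedral_blocks n A B \<and> circulant n A \<and> circulant n B \<and>
           switching_equiv (2 * n) (gram \<Phi>) (block_gram A B))) \<and>
     (genuine_dihedral_config n \<Phi> \<longrightarrow>
        (\<exists>A B. dihedral_blocks n A B \<and> negacirculant n A \<and> negacirculant n B \<and>
           switching_equiv (2 * n) (gram \<Phi>) (block_gram A B))) \<and>
     (unit_config n (2 * n) \<Phi> \<and> reduced_config (2 * n) \<Phi> \<longrightarrow>
        (\<forall>A B \<sigma>. dihedral_blocks n A B \<and>
             switching_equiv_via (2 * n) \<sigma> (gram \<Phi>) (block_gram A B) \<longrightarrow>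
           (circulant n A \<and> circulant n B \<longrightarrow>
              strict_dihedral_config n (permute_config (2 * n) \<sigma> \<Phi>)) \<and>
           (negacirculant n A \<and> negacirculant n B \<longrightarrow>
              dihedral_config n (permute_config (2 * n) \<sigma> \<Phi>) \<and>
              (even n \<longrightarrow> genuine_dihedral_config n (permute_config (2 * n) \<sigma> \<Phi>)))))"
proof (intro conjI)
  note n = assms
  have realized: "\<exists>s M T. realizes n n s M T \<pi>" if "is_dihedral_orbit n \<pi> \<Phi>" for \<pi>
    using that projective_rep_realized[OF n n] by (simp add: is_dihedral_orbit_def)
  show "dihedral_config n \<Phi> \<longrightarrow>
        (\<exists>A B. dihedral_blocks n A B \<and> switching_equiv (2 * n) (gram \<Phi>) (block_gram A B))"
    unfolding dihedral_config_def using realized realized_orbit_gram[OF n] by blast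
  show "strict_dihedral_config n \<Phi> \<longrightarrow>
        (\<exists>A B. dihedral_blocks n A B \<and> circulant n A \<and> circulant n B \<and>
           switching_equiv (2 * n) (gram \<Phi>) (block_gram A B))"
  proof
    assume "strict_dihedral_config n \<Phi>"
    then obtain \<pi> where orb: "is_dihedral_orbit n \<pi> \<Phi>" and st: "strict_type (dihedral_group n) n \<pi>"
      by (auto simp: strict_dihedral_config_def)
    have "\<pi> g \<in> carrier_mat n n" if "g \<in> carrier (dihedral_group n)" for g
      using orb that unfolding is_dihedral_orbit_def projective_rep_def
      by (blast dest: unitary_matD(1))
    then obtain M T where "realizes n n 1 M T \<pi>"
      using strict_type_realized[OF n st] by blast
    from realized_orbit_gram[OF n orb this]
    show "\<exists>A B. dihedral_blocks n A B \<and> circulant n A \<and> circulant n B \<and>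
           switching_equiv (2 * n) (gram \<Phi>) (block_gram A B)"
      by blast
  qed
  show "genuine_dihedral_config n \<Phi> \<longrightarrow>
        (\<exists>A B. dihedral_blocks n A B \<and> negacirculant n A \<and> negacirculant n B \<and>
           switching_equiv (2 * n) (gram \<Phi>) (block_gram A B))"
  proof
    assume "genuine_dihedral_config n \<Phi>"
    then obtain \<pi> where orb: "is_dihedral_orbit n \<pi> \<Phi>" and st: "\<not> strict_type (dihedral_group n) n \<pi>"
      by (auto simp: genuine_dihedral_config_def)
    obtain s M T where r: "realizes n n s M T \<pi>" using realized[OF orb] by blast
    have "s = 1 \<or> s = -1" using r dihedral_pair.sign unfolding realizes_def by blast
    \<comment> \<open>With \<open>s = 1\<close> the representation would be of strict type.\<close>
    moreover have "s \<noteq> 1" using realized_strict_type[OF n] r st by blast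
    ultimately have "s = -1" by blast
    then show "\<exists>A B. dihedral_blocks n A B \<and> negacirculant n A \<and> negacirculant n B \<and>
           switching_equiv (2 * n) (gram \<Phi>) (block_gram A B)"
      using realized_orbit_gram[OF n orb r] by blast
  qed
  show "unit_config n (2 * n) \<Phi> \<and> reduced_config (2 * n) \<Phi> \<longrightarrow>
        (\<forall>A B \<sigma>. dihedral_blocks n A B \<and>
             switching_equiv_via (2 * n) \<sigma> (gram \<Phi>) (block_gram A B) \<longrightarrow>
           (circulant n A \<and> circulant n B \<longrightarrow>
              strict_dihedral_config n (permute_config (2 * n) \<sigma> \<Phi>)) \<and>
           (negacirculant n A \<and> negacirculant n B \<longrightarrow>
              dihedral_config n (permute_config (2 * n) \<sigma> \<Phi>) \<and>
              (even n \<longrightarrow> genuine_dihedral_config n (permute_config (2 * n) \<sigma> \<Phi>))))"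
  proof (intro impI allI, elim conjE, intro conjI impI; elim conjE)
    fix A B \<sigma>
    assume hyps: "unit_config n (2 * n) \<Phi>" "dihedral_blocks n A B"
      "switching_equiv_via (2 * n) \<sigma> (gram \<Phi>) (block_gram A B)"
    note orbit = dihedral_orbit_of_gram[OF n _ hyps]
    show "strict_dihedral_config n (permute_config (2 * n) \<sigma> \<Phi>)"
      if "circulant n A" "circulant n B"
    proof -
      obtain a where a: "\<And>k. a (k + int n) = a k"
        "\<And>i j. i < n \<Longrightarrow> j < n \<Longrightarrow> A $$ (i, j) = a (int j - int i)"
        using circulant_quasi_periodic[OF \<open>circulant n A\<close>] by blast
      obtain b where b: "\<And>k. b (k + int n) = b k"
        "\<And>i j. i < n \<Longrightarrow> j < n \<Longrightarrow> B $$ (i, j) = b (int j - int i)"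
        using circulant_quasi_periodic[OF \<open>circulant n B\<close>] by blast
      have "\<exists>\<pi> M T. is_dihedral_orbit n \<pi> (permute_config (2 * n) \<sigma> \<Phi>) \<and> realizes n n 1 M T \<pi>"
        by (rule orbit[OF _ _ _ a(2) b(2)]) (simp_all add: a(1) b(1))
      then show ?thesis
        unfolding strict_dihedral_config_def using realized_strict_type[OF n] by blast
    qed
    have nega: "\<exists>\<pi> M T. is_dihedral_orbit n \<pi> (permute_config (2 * n) \<sigma> \<Phi>) \<and> realizes n n (-1) M T \<pi>"
      if "negacirculant n A" "negacirculant n B"
    proof -
      obtain a where a: "\<And>k. a (k + int n) = - a k"
        "\<And>i j. i < n \<Longrightarrow> j < n \<Longrightarrow> A $$ (i, j) = a (int j - int i)"
        using negacirculant_quasi_periodic[OF \<open>negacirculant n A\<close> n] by blast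
      obtain b where b: "\<And>k. b (k + int n) = - b k"
        "\<And>i j. i < n \<Longrightarrow> j < n \<Longrightarrow> B $$ (i, j) = b (int j - int i)"
        using negacirculant_quasi_periodic[OF \<open>negacirculant n B\<close> n] by blast
      show ?thesis
        by (rule orbit[OF _ _ _ a(2) b(2)]) (simp_all add: a(1) b(1))
    qed
    show "dihedral_config n (permute_config (2 * n) \<sigma> \<Phi>)"
      if "negacirculant n A" "negacirculant n B"
      using nega[OF that] unfolding dihedral_config_def by blast
    show "genuine_dihedral_config n (permute_config (2 * n) \<sigma> \<Phi>)"
      if "negacirculant n A" "negacirculant n B" "even n"
      using nega[OF that(1,2)] realized_not_strict_type[OF n that(3) n]
      unfolding genuine_dihedral_config_def by blast
  qed
qed

end
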